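(* Let $I_T\subset K[x_1,\dots,x_s]$ be a simple toric ideal, let $\omega\subseteq\{1,\dots,s\}$, and let $I_{A_1}$ (in polynomial variables $x$) and $I_{A_2}$ (in polynomial variables $y$) be two $T_\omega$-robust toric ideals, with associated isomorphisms $D_j:\operatorname{Ker}_{\mathbb Z}(T)\to\operatorname{Ker}_{\mathbb Z}(A_j)$, $j=1,2$. If $\mathcal G$ is a reduced Gröbner basis of $I_{A_1}$ with respect to a monomial order $<_1$, then there exists a monomial order $<_2$ such that $$\mathcal G'=\{y^{D_2(\mathbf u)^+}-y^{D_2(\mathbf u)^-}\mid \mathbf u\in\operatorname{Ker}_{\mathbb Z}(T)\text{ such that } x^{D_1(\mathbf u)^+}-x^{D_1(\mathbf u)^-}\in\mathcal G\}$$ is a reduced Gröbner basis of $I_{A_2}$ (with respect to $<_2$). Furthermore, if $\mathbf u_1,\dots,\mathbf u_r\in\operatorname{Ker}_{\mathbb Z}(T)$ are such that $$\operatorname{in}_{<_1}(I_{A_1})=(x^{D_1(\mathbf u_1)^+},\dots,x^{D_1(\mathbf u_r)^+}),$$ then $$\operatorname{in}_{<_2}(I_{A_2})=(y^{D_2(\mathbf u_1)^+},\dots,y^{D_2(\mathbf u_r)^+}).$$ Thus there exists a one-to-one correspondence between the reduced Gröbner bases of the two ideals. In particular, there is a one-to-one correspondence between the universal Gröbner bases of $I_{A_1}$ and $I_{A_2}$.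
   Context: $K$ is a field. For an integer matrix $M$ with $n$ columns, $\operatorname{Ker}_{\mathbb Z}(M)=\{\mathbf u\in\mathbb Z^n: M\mathbf u=0\}$, and the toric ideal $I_M\subset K[x_1,\dots,x_n]$ is generated by the binomials $x^{\mathbf u^+}-x^{\mathbf u^-}$, $\mathbf u\in\operatorname{Ker}_{\mathbb Z}(M)$, where $\mathbf u=\mathbf u^+-\mathbf u^-$ with $\mathbf u^\pm\in\mathbb N^n$ of disjoint supports. The matrices $A_1,A_2$ are assumed to satisfy $\operatorname{Ker}_{\mathbb Z}(A_j)\cap\mathbb N^{n_j}=\{\mathbf 0\}$, where $n_j$ is the number of columns of $A_j$ (i.e. $I_{A_j}$ is positively graded). Bouquets. Let $A=[\mathbf a_1,\dots,\mathbf a_n]\in\mathbb Z^{m\times n}$ have rank $r$. Its Gale transform is an $n\times(n-r)$ integer matrix whose columns form a basis of the lattice $\operatorname{Ker}_{\mathbb Z}(A)$; its rows are $\mathbf b_1,\dots,\mathbf b_n$. The vector $\mathbf a_i$ is free if $\mathbf b_i=\mathbf 0$. The bouquet graph has vertices $\mathbf a_1,\dots,\mathbf a_n$ and edges $\{\mathbf a_i,\mathbf a_j\}$ whenever $\mathbf b_i$ is a rational multiple of $\mathbf b_j$ and vice versa; its connected components are the bouquets. The free vectors, if any, form one bouquet, the free bouquet. A non-free bouquet is mixed if it contains an edge $\{\mathbf a_i,\mathbf a_j\}$ with $\mathbf b_i=\lambda\mathbf b_j$ for some $\lambda<0$; otherwise (isolated vertex, or $\lambda>0$ for all its edges) it is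 non-mixed. List the bouquets as $B_1,\dots,B_s$ and reorder the columns as $\mathbf a_{11},\dots,\mathbf a_{1k_1},\dots,\mathbf a_{s1},\dots,\mathbf a_{sk_s}$, with $\mathbf a_{i1},\dots,\mathbf a_{ik_i}$ the elements of $B_i$. Define $\mathbf c_{B_i}\in\mathbb Z^n$, supported on the positions $i1,\dots,ik_i$ with coordinates $c_{i1},\dots,c_{ik_i}$ there: if $B_i$ is free, $\mathbf c_{B_i}$ is any vector with support exactly $\{i1,\dots,ik_i\}$ and $c_{i1}>0$; if $B_i$ is non-free, choose an index $l$ with $(\mathbf b_{ij})_l\neq0$ for all $j$, put $g_l=\gcd((\mathbf b_{i1})_l,\dots,(\mathbf b_{ik_i})_l)$ and $c_{ij}=\varepsilon_{i1}(\mathbf b_{ij})_l/g_l$, where $\varepsilon_{i1}$ is the sign of $(\mathbf b_{i1})_l$. Let $\mathbf a_{B_i}=\sum_j c_{ij}\mathbf a_{ij}$ and $A_B=[\mathbf a_{B_1},\dots,\mathbf a_{B_s}]$; the bouquet ideal of $I_A$ is $I_{A_B}\subset K[x_1,\dots,x_s]$. The map $D(\mathbf u)=\sum_{i=1}^s u_i\mathbf c_{B_i}$ is an isomorphism $\operatorname{Ker}_{\mathbb Z}(A_B)\to\operatorname{Ker}_{\mathbb Z}(A)$ (known fact). A toric ideal is simple if every bouquet is a singleton. Given a simple toric ideal $I_T\subset K[x_1,\dots,x_s]$ and $\omega\subseteq\{1,\dots,s\}$, a toric ideal $I_A$ is $T_\omega$-robust if its bouquet ideal is $I_T$ (so $\operatorname{Ker}_{\mathbb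 Z}(A_B)=\operatorname{Ker}_{\mathbb Z}(T)$, the bouquet $B_i$ corresponding to $x_i$) and $\omega=\{i: B_i\text{ is non-mixed}\}$. For such ideals $I_{A_1},I_{A_2}$, $D_1,D_2$ denote the corresponding maps $D$. The ideal $I_{A_1}$ lives in $K[x_{11},\dots,x_{1k_1},\dots,x_{s1},\dots,x_{sk_s}]$ and $I_{A_2}$ in $K[y_{11},\dots,y_{1l_1},\dots,y_{s1},\dots,y_{sl_s}]$, where $k_i,l_i$ are the sizes of the $i$-th bouquets of $A_1,A_2$. $\operatorname{in}_{<}(I)$ is the initial ideal. The universal Gröbner basis of a toric ideal is the union of all its reduced Gröbner bases. *)

theory Defs
  imports "HOL-Analysis.Analysis" "HOL-Library.Poly_Mapping"
begin

text \<open>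
  The polynomial ring \<open>K[x\<^sub>i | i \<in> 'n]\<close> is the type \<open>('n \<Rightarrow>\<^sub>0 nat) \<Rightarrow>\<^sub>0 'k\<close>: exponent vectors
  are \<open>'n \<Rightarrow>\<^sub>0 nat\<close> (so the product of monomials is the sum of exponent vectors).
  Columns of matrices and variables are indexed by the same finite type.
\<close>

type_synonym 'n expo = "'n \<Rightarrow>\<^sub>0 nat"
type_synonym ('n, 'k) mpoly = "('n \<Rightarrow>\<^sub>0 nat) \<Rightarrow>\<^sub>0 'k"

global_interpretation ring_module: module "(*) :: 'a::comm_ring_1 \<Rightarrow> 'a \<Rightarrow> 'a"
  by unfold_locales (auto simp: algebra_simps)

global_interpretation int_vec: module "(*s) :: int \<Rightarrow> int^'n \<Rightarrow> int^'n"
  by unfold_locales (auto simp: vec_eq_iff algebra_simps)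

definition ideal :: "'a::comm_ring_1 set \<Rightarrow> 'a set" where
  "ideal S = ring_module.span S"

definition monomial :: "'n expo \<Rightarrow> ('n, 'k::comm_ring_1) mpoly" where
  "monomial m = Poly_Mapping.single m 1"


subsection \<open>Monomial orders and Groebner bases\<close>

definition monomial_order :: "('n expo \<Rightarrow> 'n expo \<Rightarrow> bool) \<Rightarrow> bool" where
  "monomial_order lt \<longleftrightarrow>
     irreflp lt \<and> transp lt \<and> totalp lt \<and>
     (\<forall>m. m \<noteq> 0 \<longrightarrow> lt 0 m) \<and>
     (\<forall>m m' q. lt m m' \<longrightarrow> lt (m + q) (m' + q))"

text \<open>Only meaningful for \<open>f \<noteq> 0\<close> and a monomial order \<open>lt\<close>.\<close>

definition lead_expo :: "('n expo \<Rightarrow> 'n expo \<Rightarrow> bool) \<Rightarrow> ('n, 'k::comm_ring_1) mpoly \<Rightarrow> 'n expo" where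
  "lead_expo lt f =
     (THE m. m \<in> Poly_Mapping.keys f \<and> (\<forall>m' \<in> Poly_Mapping.keys f. m' \<noteq> m \<longrightarrow> lt m' m))"

definition initial_ideal ::
    "('n expo \<Rightarrow> 'n expo \<Rightarrow> bool) \<Rightarrow> ('n, 'k::comm_ring_1) mpoly set \<Rightarrow> ('n, 'k) mpoly set" where
  "initial_ideal lt I = ideal ((\<lambda>f. monomial (lead_expo lt f)) ` (I - {0}))"

definition groebner_basis ::
    "('n expo \<Rightarrow> 'n expo \<Rightarrow> bool) \<Rightarrow> ('n, 'k::field) mpoly set \<Rightarrow> ('n, 'k) mpoly set \<Rightarrow> bool" where
  "groebner_basis lt I \<G> \<longleftrightarrow>
     finite \<G> \<and> \<G> \<subseteq> I \<and>
     initial_ideal lt I = ideal ((\<lambda>g. monomial (lead_expo lt g)) ` (\<G> - {0}))"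

definition reduced_groebner_basis ::
    "('n expo \<Rightarrow> 'n expo \<Rightarrow> bool) \<Rightarrow> ('n, 'k::field) mpoly set \<Rightarrow> ('n, 'k) mpoly set \<Rightarrow> bool" where
  "reduced_groebner_basis lt I \<G> \<longleftrightarrow>
     groebner_basis lt I \<G> \<and> 0 \<notin> \<G> \<and>
     (\<forall>g\<in>\<G>. Poly_Mapping.lookup g (lead_expo lt g) = 1) \<and>
     (\<forall>g\<in>\<G>. \<forall>h\<in>\<G>. g \<noteq> h \<longrightarrow>
        (\<forall>m \<in> Poly_Mapping.keys g. \<not> (\<exists>q. m = lead_expo lt h + q)))"

definition reduced_groebner_bases :: "('n, 'k::field) mpoly set \<Rightarrow> ('n, 'k) mpoly set set" where
  "reduced_groebner_bases I = {\<G>. \<exists>lt. monomial_order lt \<and> reduced_groebner_basis lt I \<G>}"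

definition universal_groebner_basis :: "('n, 'k::field) mpoly set \<Rightarrow> ('n, 'k) mpoly set" where
  "universal_groebner_basis I = \<Union> (reduced_groebner_bases I)"


subsection \<open>Toric ideals\<close>

definition kerZ :: "int^'n^'m \<Rightarrow> (int^'n) set" where
  "kerZ A = {u. A *v u = 0}"

definition positively_graded :: "int^'n^'m \<Rightarrow> bool" where
  "positively_graded A \<longleftrightarrow> kerZ A \<inter> {u. \<forall>i. 0 \<le> u $ i} = {0}"

text \<open>\<open>nat\<close> truncates negative integers to \<open>0\<close>; the support is finite because \<open>'n\<close> is.\<close>

definition pos_part :: "int^'n \<Rightarrow> 'n expo" where
  "pos_part u = Abs_poly_mapping (\<lambda>i. nat (u $ i))"

definition neg_part :: "int^'n \<Rightarrow> 'n expo" where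
  "neg_part u = Abs_poly_mapping (\<lambda>i. nat (- (u $ i)))"

definition toric_binomial :: "int^'n \<Rightarrow> ('n, 'k::comm_ring_1) mpoly" where
  "toric_binomial u = monomial (pos_part u) - monomial (neg_part u)"

definition toric_ideal :: "int^'n^'m \<Rightarrow> ('n, 'k::comm_ring_1) mpoly set" where
  "toric_ideal A = ideal (toric_binomial ` kerZ A)"


subsection \<open>Gale transforms and bouquets\<close>

text \<open>
  A Gale transform is given by the list of its columns, since its width \<open>n - rank A\<close> (which may
  be \<open>0\<close>) is determined only by \<open>A\<close>.
\<close>

definition gale_transform :: "int^'n^'m \<Rightarrow> (int^'n) list \<Rightarrow> bool" where
  "gale_transform A G \<longleftrightarrow>
     distinct G \<and> int_vec.independent (set G) \<and> int_vec.span (set G) = kerZ A"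

definition gale_row :: "(int^'n) list \<Rightarrow> 'n \<Rightarrow> int list" where
  "gale_row G i = map (\<lambda>v. v $ i) G"

definition free_vector :: "(int^'n) list \<Rightarrow> 'n \<Rightarrow> bool" where
  "free_vector G i \<longleftrightarrow> (\<forall>x \<in> set (gale_row G i). x = 0)"

definition is_multiple :: "rat \<Rightarrow> int list \<Rightarrow> int list \<Rightarrow> bool" where
  "is_multiple q b b' \<longleftrightarrow> map rat_of_int b = map (\<lambda>x. q * rat_of_int x) b'"

text \<open>The vertices of the bouquet graph are the column indices, not the columns themselves.\<close>

definition bouquet_edge :: "(int^'n) list \<Rightarrow> 'n \<Rightarrow> 'n \<Rightarrow> bool" where
  "bouquet_edge G i j \<longleftrightarrow> i \<noteq> j \<and>
     (\<exists>q. is_multiple q (gale_row G i) (gale_row G j)) \<and>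
     (\<exists>q. is_multiple q (gale_row G j) (gale_row G i))"

definition bouquets :: "(int^'n) list \<Rightarrow> 'n set set" where
  "bouquets G = range (\<lambda>i. {j. (bouquet_edge G)\<^sup>*\<^sup>* i j})"

definition free_bouquet :: "(int^'n) list \<Rightarrow> 'n set \<Rightarrow> bool" where
  "free_bouquet G S \<longleftrightarrow> (\<forall>i\<in>S. free_vector G i)"

definition mixed_bouquet :: "(int^'n) list \<Rightarrow> 'n set \<Rightarrow> bool" where
  "mixed_bouquet G S \<longleftrightarrow> \<not> free_bouquet G S \<and>
     (\<exists>i\<in>S. \<exists>j\<in>S. bouquet_edge G i j \<and>
        (\<exists>q<0. is_multiple q (gale_row G i) (gale_row G j)))"

text \<open>The free bouquet is neither mixed nor non-mixed.\<close>

definition non_mixed_bouquet :: "(int^'n) list \<Rightarrow> 'n set \<Rightarrow> bool" where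
  "non_mixed_bouquet G S \<longleftrightarrow> \<not> free_bouquet G S \<and> \<not> mixed_bouquet G S"

definition simple_toric :: "int^'n^'m \<Rightarrow> bool" where
  "simple_toric T \<longleftrightarrow>
     (\<exists>G. gale_transform T G \<and> (\<forall>S \<in> bouquets G. card S = 1))"

text \<open>
  \<open>c\<close> is an admissible vector \<open>c\<^bsub>S\<^esub>\<close> for the bouquet \<open>S\<close> whose first listed element is \<open>f\<close>.
  The number \<open>G ! l $ j\<close> is the \<open>l\<close>-th coordinate of the row \<open>b\<^sub>j\<close>; the division is exact.
\<close>

definition bouquet_vector :: "(int^'n) list \<Rightarrow> 'n set \<Rightarrow> 'n \<Rightarrow> int^'n \<Rightarrow> bool" where
  "bouquet_vector G S f c \<longleftrightarrow>
     (\<forall>j. j \<notin> S \<longrightarrow> c $ j = 0) \<and>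
     (if free_bouquet G S
      then (\<forall>j\<in>S. c $ j \<noteq> 0) \<and> c $ f > 0
      else (\<exists>l<length G. (\<forall>j\<in>S. G ! l $ j \<noteq> 0) \<and>
              (\<forall>j\<in>S. c $ j = sgn (G ! l $ f) * (G ! l $ j) div Gcd ((\<lambda>j'. G ! l $ j') ` S))))"

text \<open>
  A listing \<open>B\<close> of the bouquets by the index type \<open>'s\<close>, with first elements \<open>f\<close> and
  vectors \<open>c\<close>.
\<close>

definition bouquet_structure ::
    "int^'n^'m \<Rightarrow> (int^'n) list \<Rightarrow> ('s \<Rightarrow> 'n set) \<Rightarrow> ('s \<Rightarrow> 'n) \<Rightarrow> ('s \<Rightarrow> int^'n) \<Rightarrow> bool" where
  "bouquet_structure A G B f c \<longleftrightarrow>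
     gale_transform A G \<and> bij_betw B UNIV (bouquets G) \<and>
     (\<forall>i. f i \<in> B i) \<and> (\<forall>i. bouquet_vector G (B i) (f i) (c i))"

definition bouquet_matrix :: "int^'n^'m \<Rightarrow> ('s \<Rightarrow> int^'n) \<Rightarrow> int^'s^'m" where
  "bouquet_matrix A c = (\<chi> k i. (A *v c i) $ k)"

definition bouquet_map :: "('s::finite \<Rightarrow> int^'n) \<Rightarrow> int^'s \<Rightarrow> int^'n" where
  "bouquet_map c u = (\<Sum>i\<in>UNIV. (u $ i) *s c i)"

text \<open>
  \<open>I\<close> is the simple toric ideal \<open>I\<^sub>T\<close>.  That the bouquet \<open>B i\<close> corresponds to the variable
  \<open>x\<^sub>i\<close> is built into the indexing of \<open>B\<close> by \<open>'s\<close>.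
\<close>

definition robust ::
    "('s::finite, 'k::comm_ring_1) mpoly set \<Rightarrow> 's set \<Rightarrow> int^'n^'m \<Rightarrow>
     (int^'n) list \<Rightarrow> ('s \<Rightarrow> 'n set) \<Rightarrow> ('s \<Rightarrow> 'n) \<Rightarrow> ('s \<Rightarrow> int^'n) \<Rightarrow> bool" where
  "robust I \<omega> A G B f c \<longleftrightarrow>
     bouquet_structure A G B f c \<and>
     toric_ideal (bouquet_matrix A c) = I \<and>
     \<omega> = {i. non_mixed_bouquet G (B i)}"

text \<open>The passage from \<open>\<G>\<close> to \<open>\<G>'\<close>, for \<open>D\<^sub>1, D\<^sub>2\<close> the maps belonging to two robust ideals.\<close>

definition corresponding_basis ::
    "int^'s^'t \<Rightarrow> (int^'s \<Rightarrow> int^'n) \<Rightarrow> (int^'s \<Rightarrow> int^'p) \<Rightarrow>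
     ('n, 'k::comm_ring_1) mpoly set \<Rightarrow> ('p, 'k) mpoly set" where
  "corresponding_basis T D\<^sub>1 D\<^sub>2 \<G> =
     {toric_binomial (D\<^sub>2 u) | u. u \<in> kerZ T \<and> toric_binomial (D\<^sub>1 u) \<in> \<G>}"

end

theory Submission
  imports Defs
begin

text \<open>
  For a monomial order, the reduced Groebner basis of a toric ideal consists of the binomials of those
  positive kernel vectors \<open>u\<close> for which the positive part is a minimal leading monomial and the negative
  part is standard (\<open>reduced_groebner_basis_toric_iff\<close>). This description uses only two things: which
  kernel vectors are positive for the order, and which positive parts of kernel vectors divide one
  another. The initial ideal is determined by the same data (\<open>initial_toric_ideal\<close>). So it suffices
  to transport both along \<open>D\<^sub>2 \<circ> D\<^sub>1\<^bsup>-1\<^esup>\<close>.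

  Divisibility is transported because a bouquet map replaces the coordinate \<open>u\<^sub>i\<close> by the block \<open>u\<^sub>i c\<^sub>i\<close>. If
  the bouquet is non-mixed, all entries of \<open>c\<^sub>i\<close> are positive and the positive part of the block
  records \<open>u\<^sub>i\<^sup>+\<close>; if it is mixed, both signs occur and the block records \<open>u\<^sub>i\<^sup>+\<close> and \<open>u\<^sub>i\<^sup>-\<close>; if it is
  free, \<open>u\<^sub>i\<close> is zero on the kernel. Divisibility therefore depends only on \<open>\<omega>\<close>
  (\<open>pos_part_bouquet_map_dvd_iff\<close>). That bouquet maps are isomorphisms of kernel lattices is
  \<open>bouquet_map_bij\<close>.

  Positivity is transported by the choice of the second order (\<open>transfer_order\<close>). A monomial order
  is a total group order on integer vectors that is positive on the orthant. The cone generated by the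
  orthant and by all \<open>D\<^sub>2 u\<close> with \<open>D\<^sub>1 u\<close> positive is pointed, because the second ideal is positively
  graded, and a pointed cone in a torsion-free abelian group extends to a total order by Zorn's lemma
  (\<open>total_cone_extension\<close>). The resulting order gives \<open>D\<^sub>2 u\<close> the sign of \<open>D\<^sub>1 u\<close> for every kernel vector
  \<open>u\<close>, not only for the finitely many in a basis, so it serves for the initial ideal as well.

  Both ingredients are symmetric in the two ideals. The passage from one family of reduced bases to the
  other thus has an inverse, and so has the induced map on universal Groebner bases.
\<close>

section \<open>Divisibility and monomial ideals\<close>

text \<open>
  The coordinatewise form suits bouquet maps, which act on blocks of coordinates; the connection with
  products of monomials is \<open>expo_dvd_iff\<close>.
\<close>

definition expo_dvd :: "'n expo \<Rightarrow> 'n expo \<Rightarrow> bool" where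
  "expo_dvd a b \<longleftrightarrow> (\<forall>i. Poly_Mapping.lookup a i \<le> Poly_Mapping.lookup b i)"

lemma expo_dvd_iff: "expo_dvd a b \<longleftrightarrow> (\<exists>q. b = a + q)"
proof
  assume "expo_dvd a b"
  then have "b = a + (b - a)"
    by (intro poly_mapping_eqI) (simp add: expo_dvd_def lookup_add lookup_minus)
  then show "\<exists>q. b = a + q" ..
qed (auto simp: expo_dvd_def lookup_add)

lemma expo_dvd_refl [simp]: "expo_dvd a a"
  by (simp add: expo_dvd_def)

lemma expo_dvd_trans: "expo_dvd a b \<Longrightarrow> expo_dvd b c \<Longrightarrow> expo_dvd a c"
  unfolding expo_dvd_def using le_trans by blast

lemma expo_dvd_antisym: "expo_dvd a b \<Longrightarrow> expo_dvd b a \<Longrightarrow> a = b"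
  by (intro poly_mapping_eqI) (simp add: expo_dvd_def le_antisym)

lemma keys_monomial [simp]: "Poly_Mapping.keys (monomial m :: ('n, 'k::field) mpoly) = {m}"
  by (simp add: monomial_def)

lemma monomial_add: "monomial (a + b) = (monomial a * monomial b :: ('n, 'k::field) mpoly)"
  by (simp add: monomial_def mult_single)

lemma ideal_base: "x \<in> S \<Longrightarrow> x \<in> ideal S"
  unfolding ideal_def by (rule ring_module.span_base)

lemma ideal_mult: "x \<in> ideal S \<Longrightarrow> c * x \<in> ideal S"
  unfolding ideal_def by (rule ring_module.span_scale)

lemma ideal_diff: "x \<in> ideal S \<Longrightarrow> y \<in> ideal S \<Longrightarrow> x - y \<in> ideal S"
  unfolding ideal_def by (rule ring_module.span_diff)

lemma ideal_subset_iff: "ideal S \<subseteq> ideal S' \<longleftrightarrow> S \<subseteq> ideal S'"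
  unfolding ideal_def
  using ring_module.span_superset ring_module.span_minimal ring_module.subspace_span by blast

lemma keys_in_monomial_ideal:
  fixes f :: "('n, 'k::field) mpoly"
  assumes "f \<in> ideal (monomial ` S)" "m \<in> Poly_Mapping.keys f"
  shows "\<exists>s\<in>S. expo_dvd s m"
  using assms unfolding ideal_def
proof (induction arbitrary: m rule: ring_module.span_induct_alt)
  case base
  then show ?case by simp
next
  case (step c x y)
  then obtain s where s: "s \<in> S" "x = monomial s" by blast
  from step.prems have "m \<in> Poly_Mapping.keys (c * x) \<or> m \<in> Poly_Mapping.keys y"
    using keys_add[of "c * x" y] by blast
  then show ?case
  proof
    assume "m \<in> Poly_Mapping.keys (c * x)"
    then obtain a where "m = a + s"
      using keys_mult[of c x] s by auto
    then have "expo_dvd s m" by (auto simp: expo_dvd_iff add.commute)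
    then show ?thesis using s by blast
  qed (use step.IH in blast)
qed

lemma monomial_in_ideal_iff:
  "(monomial m :: ('n, 'k::field) mpoly) \<in> ideal (monomial ` S) \<longleftrightarrow> (\<exists>s\<in>S. expo_dvd s m)"
proof
  assume "\<exists>s\<in>S. expo_dvd s m"
  then obtain s q where s: "s \<in> S" "m = s + q" by (auto simp: expo_dvd_iff)
  then have "(monomial m :: ('n, 'k) mpoly) = monomial q * monomial s"
    by (simp add: monomial_add mult.commute)
  then show "(monomial m :: ('n, 'k) mpoly) \<in> ideal (monomial ` S)"
    using s by (simp add: ideal_mult ideal_base)
qed (use keys_in_monomial_ideal[where f = "monomial m :: ('n, 'k) mpoly"] in simp)

text \<open>
  Through this criterion, equalities of initial ideals become statements about divisibility between
  exponents, which make sense simultaneously in two polynomial rings.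
\<close>

lemma monomial_ideal_eq_iff:
  "(ideal (monomial ` S) :: ('n, 'k::field) mpoly set) = ideal (monomial ` S') \<longleftrightarrow>
     (\<forall>s\<in>S. \<exists>s'\<in>S'. expo_dvd s' s) \<and> (\<forall>s'\<in>S'. \<exists>s\<in>S. expo_dvd s s')"
  unfolding set_eq_subset ideal_subset_iff image_subset_iff monomial_in_ideal_iff ..

section \<open>Leading exponents\<close>

context
  fixes lt :: "'n expo \<Rightarrow> 'n expo \<Rightarrow> bool"
  assumes lt: "monomial_order lt"
begin

lemma order_irrefl: "\<not> lt m m"
  using lt by (simp add: monomial_order_def irreflp_def)

lemma order_trans: "lt a b \<Longrightarrow> lt b c \<Longrightarrow> lt a c"
  using lt unfolding monomial_order_def by (blast dest: transpD)

lemma order_total: "a \<noteq> b \<Longrightarrow> lt a b \<or> lt b a"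
  using lt unfolding monomial_order_def by (blast dest: totalpD)

lemma order_add_cancel: "lt (a + q) (b + q) \<longleftrightarrow> lt a b"
  using lt unfolding monomial_order_def
  by (metis order_irrefl order_total order_trans)

lemma order_dvd: "expo_dvd a b \<Longrightarrow> a = b \<or> lt a b"
proof -
  assume "expo_dvd a b"
  then obtain q where "b = a + q" by (auto simp: expo_dvd_iff)
  moreover have "q \<noteq> 0 \<Longrightarrow> lt (0 + a) (q + a)"
    using lt unfolding monomial_order_def by blast
  ultimately show ?thesis by (cases "q = 0") (auto simp: add.commute)
qed

lemma exists_greatest:
  assumes "finite M" "M \<noteq> {}"
  shows "\<exists>m\<in>M. \<forall>m'\<in>M. m' \<noteq> m \<longrightarrow> lt m' m"
  using assms
proof (induction rule: finite_ne_induct)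
  case (insert x F)
  then obtain m where m: "m \<in> F" "\<forall>m'\<in>F. m' \<noteq> m \<longrightarrow> lt m' m" by blast
  consider "lt x m" | "lt m x" using order_total m insert.hyps by metis
  then show ?case
  proof cases
    case 2
    then have "lt m' x" if "m' \<in> F" for m'
      using that m order_trans by metis
    then have "\<forall>m'\<in>insert x F. m' \<noteq> x \<longrightarrow> lt m' x" by auto
    then show ?thesis by (rule bexI) simp
  next
    case 1
    then have "\<forall>m'\<in>insert x F. m' \<noteq> m \<longrightarrow> lt m' m" using m by auto
    then show ?thesis using m(1) by (intro bexI[of _ m]) auto
  qed
qed simp

lemma lead_expo_eqI:
  assumes "m \<in> Poly_Mapping.keys f" "\<And>m'. m' \<in> Poly_Mapping.keys f \<Longrightarrow> m' \<noteq> m \<Longrightarrow> lt m' m"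
  shows "lead_expo lt f = m"
  unfolding lead_expo_def
proof (rule the_equality)
  fix x assume "x \<in> Poly_Mapping.keys f \<and> (\<forall>m'\<in>Poly_Mapping.keys f. m' \<noteq> x \<longrightarrow> lt m' x)"
  then show "x = m" using assms order_irrefl[of m] order_trans[of m x m] by metis
qed (use assms in simp)

lemma lead_expo:
  assumes "f \<noteq> 0"
  shows lead_expo_in_keys: "lead_expo lt f \<in> Poly_Mapping.keys f"
    and lead_expo_greatest:
      "m' \<in> Poly_Mapping.keys f \<Longrightarrow> m' \<noteq> lead_expo lt f \<Longrightarrow> lt m' (lead_expo lt f)"
proof -
  obtain m where m: "m \<in> Poly_Mapping.keys f"
      "\<forall>m'\<in>Poly_Mapping.keys f. m' \<noteq> m \<longrightarrow> lt m' m"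
    using exists_greatest[of "Poly_Mapping.keys f"] assms by auto
  have "lead_expo lt f = m" using m by (intro lead_expo_eqI) auto
  then show "lead_expo lt f \<in> Poly_Mapping.keys f"
    "m' \<in> Poly_Mapping.keys f \<Longrightarrow> m' \<noteq> lead_expo lt f \<Longrightarrow> lt m' (lead_expo lt f)"
    using m by auto
qed

end

section \<open>Monomial orders as orders on integer vectors\<close>

definition expo_vec :: "'n expo \<Rightarrow> int^'n" where
  "expo_vec m = (\<chi> i. int (Poly_Mapping.lookup m i))"

lemma expo_vec_add: "expo_vec (a + b) = expo_vec a + expo_vec b"
  by (simp add: expo_vec_def lookup_add vec_eq_iff)

lemma expo_vec_inject: "expo_vec a = expo_vec b \<longleftrightarrow> a = b"
  by (auto simp: expo_vec_def vec_eq_iff intro: poly_mapping_eqI)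

lemma lookup_pos_part [simp]: "Poly_Mapping.lookup (pos_part u) i = nat (u $ i)"
  by (simp add: pos_part_def Abs_poly_mapping_inverse)

lemma neg_part_eq: "neg_part u = pos_part (- u)"
  by (simp add: pos_part_def neg_part_def)

lemma lookup_neg_part [simp]: "Poly_Mapping.lookup (neg_part u) i = nat (- (u $ i))"
  by (simp add: neg_part_eq)

lemma expo_vec_parts: "expo_vec (pos_part u) - expo_vec (neg_part u) = u"
  by (simp add: expo_vec_def vec_eq_iff)

lemma parts_eq_iff: "pos_part u = neg_part u \<longleftrightarrow> u = 0"
proof
  assume "pos_part u = neg_part u"
  then show "u = 0" using expo_vec_parts[of u] by simp
qed (simp add: neg_part_eq)

lemma pos_part_dvd: "u = expo_vec m - expo_vec m' \<Longrightarrow> expo_dvd (pos_part u) m"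
  by (auto simp: expo_dvd_def expo_vec_def)

lemma expo_exchange:
  "m + neg_part (expo_vec m - expo_vec m') = m' + pos_part (expo_vec m - expo_vec m')"
  by (intro poly_mapping_eqI) (simp add: lookup_add expo_vec_def)

text \<open>
  A monomial order extends uniquely to a translation invariant total order of the group of integer
  vectors; these are its positive elements.
\<close>

definition order_pos :: "('n expo \<Rightarrow> 'n expo \<Rightarrow> bool) \<Rightarrow> int^'n \<Rightarrow> bool" where
  "order_pos lt u \<longleftrightarrow> lt (neg_part u) (pos_part u)"

lemma order_pos_diff_iff:
  assumes "monomial_order lt"
  shows "order_pos lt (expo_vec m - expo_vec m') \<longleftrightarrow> lt m' m"
proof -
  define u where "u = expo_vec m - expo_vec m'"
  have "lt m' m \<longleftrightarrow> lt (m' + neg_part u) (m + neg_part u)"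
    by (simp add: order_add_cancel[OF assms])
  also have "\<dots> \<longleftrightarrow> lt (neg_part u + m') (pos_part u + m')"
    using expo_exchange[of m m'] by (simp add: u_def add.commute)
  finally show ?thesis
    by (simp add: order_add_cancel[OF assms] order_pos_def u_def)
qed

lemma order_pos_add:
  assumes lt: "monomial_order lt" and "order_pos lt u" "order_pos lt v"
  shows "order_pos lt (u + v)"
proof -
  have "lt (neg_part u + neg_part v) (pos_part u + neg_part v)"
    "lt (neg_part v + pos_part u) (pos_part v + pos_part u)"
    using assms by (simp_all add: order_add_cancel[OF lt] order_pos_def)
  then have "lt (neg_part u + neg_part v) (pos_part u + pos_part v)"
    using order_trans[OF lt] by (simp add: add.commute)
  moreover have "u + v = expo_vec (pos_part u + pos_part v) - expo_vec (neg_part u + neg_part v)"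
    using expo_vec_parts[of u] expo_vec_parts[of v] by (simp add: expo_vec_add algebra_simps)
  ultimately show ?thesis using order_pos_diff_iff[OF lt] by metis
qed

lemma order_pos_irrefl: "monomial_order lt \<Longrightarrow> \<not> order_pos lt 0"
  by (simp add: order_pos_def neg_part_eq order_irrefl)

lemma order_pos_total: "monomial_order lt \<Longrightarrow> u \<noteq> 0 \<Longrightarrow> order_pos lt u \<or> order_pos lt (- u)"
  using order_total[of lt "neg_part u" "pos_part u"] parts_eq_iff[of u]
  by (auto simp: order_pos_def neg_part_eq)

lemma order_pos_asym: "monomial_order lt \<Longrightarrow> order_pos lt u \<Longrightarrow> \<not> order_pos lt (- u)"
  using order_pos_add[of lt u "- u"] order_pos_irrefl[of lt] by auto

text \<open>
  The converse passage: the nonnegative cone of a total group order restricts to a monomial order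
  as soon as it contains the nonnegative orthant.
\<close>

lemma monomial_order_of_cone:
  fixes Q :: "(int^'n) set"
  assumes add: "\<And>x y. x \<in> Q \<Longrightarrow> y \<in> Q \<Longrightarrow> x + y \<in> Q"
    and pointed: "\<And>x. x \<in> Q \<Longrightarrow> - x \<in> Q \<Longrightarrow> x = 0"
    and total: "\<And>x. x \<in> Q \<or> - x \<in> Q"
    and nonneg: "\<And>x. (\<forall>i. 0 \<le> x $ i) \<Longrightarrow> x \<in> Q"
  obtains lt where "monomial_order lt" "\<And>u. order_pos lt u \<longleftrightarrow> u \<in> Q \<and> u \<noteq> 0"
proof
  define lt where "lt m m' \<longleftrightarrow> m \<noteq> m' \<and> expo_vec m' - expo_vec m \<in> Q" for m m' :: "'n expo"
  show "order_pos lt u \<longleftrightarrow> u \<in> Q \<and> u \<noteq> 0" for u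
    using parts_eq_iff[of u] by (auto simp: order_pos_def lt_def expo_vec_parts)
  show "monomial_order lt"
    unfolding monomial_order_def
  proof (intro conjI allI impI)
    show "irreflp lt" by (simp add: irreflp_def lt_def)
    show "transp lt"
    proof (rule transpI)
      fix a b c assume ab: "lt a b" and bc: "lt b c"
      have "expo_vec c - expo_vec a \<in> Q"
        using add[of "expo_vec c - expo_vec b" "expo_vec b - expo_vec a"] ab bc
        by (simp add: lt_def)
      moreover have "a \<noteq> c"
        using ab bc pointed[of "expo_vec b - expo_vec a"]
        by (auto simp: lt_def expo_vec_inject)
      ultimately show "lt a c" by (simp add: lt_def)
    qed
    show "totalp lt"
      unfolding totalp_on_def
      using total[of "expo_vec b - expo_vec a" for a b] by (auto simp: lt_def)
    show "lt 0 m" if "m \<noteq> 0" for m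
      using that nonneg by (auto simp: lt_def expo_vec_def)
    show "lt (m + q) (m' + q)" if "lt m m'" for m m' q
      using that by (simp add: lt_def expo_vec_add)
  qed
qed

text \<open>
  The group of integer vectors is torsion-free, and this makes it orderable compatibly with any
  given pointed cone. A cone that is maximal by Zorn's lemma must be total: if neither \<open>x\<close> nor \<open>-x\<close>
  can be added without destroying pointedness, then a positive multiple of \<open>-x\<close> and a positive
  multiple of \<open>x\<close> both lie in the cone, hence a common multiple does with both signs, and \<open>x = 0\<close>.
\<close>

lemma total_cone_extension:
  fixes C :: "(int^'n) set"
  assumes zero: "0 \<in> C"
    and add: "\<And>x y. x \<in> C \<Longrightarrow> y \<in> C \<Longrightarrow> x + y \<in> C"
    and pointed: "\<And>x. x \<in> C \<Longrightarrow> - x \<in> C \<Longrightarrow> x = 0"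
  shows "\<exists>Q. C \<subseteq> Q \<and> (\<forall>x\<in>Q. \<forall>y\<in>Q. x + y \<in> Q) \<and>
    (\<forall>x\<in>Q. - x \<in> Q \<longrightarrow> x = 0) \<and> (\<forall>x. x \<in> Q \<or> - x \<in> Q)"
proof -
  define cones where "cones = {P. C \<subseteq> P \<and> (\<forall>x\<in>P. \<forall>y\<in>P. x + y \<in> P) \<and>
    (\<forall>x\<in>P. - x \<in> P \<longrightarrow> x = 0)}"
  have "\<Union>\<C> \<in> cones" if ne: "\<C> \<noteq> {}" and chain: "subset.chain cones \<C>" for \<C>
  proof -
    have linear: "P \<subseteq> P' \<or> P' \<subseteq> P" if "P \<in> \<C>" "P' \<in> \<C>" for P P'
      using that chain by (auto simp: subset_chain_def)
    have common: "\<exists>P\<in>\<C>. x \<in> P \<and> y \<in> P" if xy: "x \<in> \<Union>\<C>" "y \<in> \<Union>\<C>" for x y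
    proof -
      obtain P P' where "P \<in> \<C>" "x \<in> P" "P' \<in> \<C>" "y \<in> P'" using xy by auto
      then show ?thesis using linear[of P P'] by blast
    qed
    have cone: "P \<in> cones" if "P \<in> \<C>" for P
      using that chain by (auto simp: subset_chain_def)
    obtain P\<^sub>0 where "P\<^sub>0 \<in> \<C>" using ne by blast
    then have "C \<subseteq> P\<^sub>0" using cone[of P\<^sub>0] by (simp add: cones_def)
    then have "C \<subseteq> \<Union>\<C>" using \<open>P\<^sub>0 \<in> \<C>\<close> by blast
    moreover have "x + y \<in> \<Union>\<C>" if xy: "x \<in> \<Union>\<C>" "y \<in> \<Union>\<C>" for x y
    proof -
      obtain P where P: "P \<in> \<C>" "x \<in> P" "y \<in> P" using common[OF xy] by blast
      then have "x + y \<in> P" using cone[of P] by (simp add: cones_def)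
      then show ?thesis using P by blast
    qed
    moreover have "x = 0" if xy: "x \<in> \<Union>\<C>" "- x \<in> \<Union>\<C>" for x
    proof -
      obtain P where P: "P \<in> \<C>" "x \<in> P" "- x \<in> P" using common[OF xy] by blast
      then show "x = 0" using cone[of P] by (simp add: cones_def)
    qed
    ultimately show ?thesis by (simp add: cones_def)
  qed
  moreover have "C \<in> cones" using add pointed by (auto simp: cones_def)
  ultimately obtain Q where Q: "Q \<in> cones" and max: "\<And>P. P \<in> cones \<Longrightarrow> Q \<subseteq> P \<Longrightarrow> P = Q"
    using subset_Zorn_nonempty[of cones] by blast
  have CQ: "C \<subseteq> Q" and Q_add: "\<And>x y. x \<in> Q \<Longrightarrow> y \<in> Q \<Longrightarrow> x + y \<in> Q"
    and Q_pointed: "\<And>x. x \<in> Q \<Longrightarrow> - x \<in> Q \<Longrightarrow> x = 0"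
    using Q by (auto simp: cones_def)
  have Q0: "0 \<in> Q" using CQ zero by blast
  have Q_scale: "int n *s x \<in> Q" if "x \<in> Q" for n x
  proof (induction n)
    case (Suc n)
    then show ?case using Q_add[OF that Suc.IH] by (simp add: vector_sadd_rdistrib)
  qed (simp add: Q0)
  \<comment> \<open>Maximality of \<open>Q\<close>: the cone generated by \<open>Q\<close> and a new vector \<open>x\<close> is not pointed.\<close>
  have multiple: "\<exists>k>0. - (int k *s x) \<in> Q" if "x \<notin> Q" for x
  proof -
    define P where "P = {p + int k *s x | p k. p \<in> Q}"
    have "Q \<subseteq> P"
    proof
      fix p assume "p \<in> Q"
      then have "p = p + int 0 *s x \<and> p \<in> Q" by simp
      then show "p \<in> P" unfolding P_def by blast
    qed
    moreover have "x \<in> P"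
    proof -
      have "x = 0 + int 1 *s x" by simp
      then show ?thesis unfolding P_def using Q0 by blast
    qed
    ultimately have "P \<notin> cones" using max that by blast
    moreover have "y + z \<in> P" if yz: "y \<in> P" "z \<in> P" for y z
    proof -
      obtain p k p' k' where *: "y = p + int k *s x" "z = p' + int k' *s x" "p \<in> Q" "p' \<in> Q"
        using yz unfolding P_def by blast
      then have "y + z = (p + p') + int (k + k') *s x"
        by (simp add: vector_sadd_rdistrib)
      then show ?thesis unfolding P_def using Q_add * by blast
    qed
    ultimately obtain y where y: "y \<in> P" "- y \<in> P" "y \<noteq> 0"
      using \<open>Q \<subseteq> P\<close> CQ unfolding cones_def by auto
    then obtain p k p' k' where *: "y = p + int k *s x" "- y = p' + int k' *s x" "p \<in> Q" "p' \<in> Q"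
      unfolding P_def by blast
    have "(p + int k *s x) + (p' + int k' *s x) = 0"
      using *(1,2) by (metis add.right_inverse)
    then have "(p + p') + int (k + k') *s x = 0"
      by (simp add: vector_sadd_rdistrib algebra_simps)
    then have "- (int (k + k') *s x) = p + p'"
      by (metis add_eq_0_iff2 minus_minus)
    then have "- (int (k + k') *s x) \<in> Q" using Q_add * by simp
    moreover have "k + k' \<noteq> 0"
    proof
      assume "k + k' = 0"
      then have "k = 0" "k' = 0" by simp_all
      then have "p = y" "p' = - y" using *(1,2) by simp_all
      then show False using *(3,4) Q_pointed y(3) by blast
    qed
    ultimately show ?thesis by blast
  qed
  have Q_total: "x \<in> Q \<or> - x \<in> Q" for x
  proof (rule ccontr)
    assume neg: "\<not> ?thesis"
    obtain k where k: "k > 0" "- (int k *s x) \<in> Q" using multiple neg by blast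
    obtain l where l: "l > 0" "- (int l *s (- x)) \<in> Q" using multiple neg by blast
    have "int k *s (- (int l *s (- x))) \<in> Q" "int l *s (- (int k *s x)) \<in> Q"
      using Q_scale k l by blast+
    moreover have "int l *s (- (int k *s x)) = - (int k *s (- (int l *s (- x))))"
      by (simp add: vec_eq_iff)
    ultimately have "int k *s (- (int l *s (- x))) = 0" using Q_pointed by metis
    then have "x = 0" using k l by (simp add: vec_eq_iff)
    then show False using neg Q0 by simp
  qed
  show ?thesis
    by (intro exI[of _ Q] conjI allI ballI impI CQ Q_add Q_pointed Q_total)
qed

section \<open>Kernel lattices\<close>

lemma kerZ_zero: "0 \<in> kerZ A"
  by (simp add: kerZ_def)

lemma kerZ_add: "u \<in> kerZ A \<Longrightarrow> v \<in> kerZ A \<Longrightarrow> u + v \<in> kerZ A"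
  by (simp add: kerZ_def matrix_vector_right_distrib)

lemma kerZ_diff: "u \<in> kerZ A \<Longrightarrow> v \<in> kerZ A \<Longrightarrow> u - v \<in> kerZ A"
  by (simp add: kerZ_def matrix_vector_mult_diff_distrib)

lemma kerZ_uminus: "u \<in> kerZ A \<Longrightarrow> - u \<in> kerZ A"
  using kerZ_diff[OF kerZ_zero] by fastforce

section \<open>Fibres of toric ideals\<close>

text \<open>
  For \<open>F\<close> a fibre, that is, the set of monomials of one degree in the grading by the columns of the
  matrix, this functional vanishes on the toric ideal.
\<close>

definition coeff_sum :: "'n expo set \<Rightarrow> ('n, 'k::field) mpoly \<Rightarrow> 'k" where
  "coeff_sum F f = (\<Sum>m\<in>Poly_Mapping.keys f. if m \<in> F then Poly_Mapping.lookup f m else 0)"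

lemma coeff_sum_add: "coeff_sum F (f + g) = coeff_sum F f + coeff_sum F g"
  unfolding coeff_sum_def
  by (rule setsum_keys_plus_distrib[where f = "\<lambda>m a. if m \<in> F then a else 0"]) simp_all

lemma coeff_sum_zero [simp]: "coeff_sum F 0 = 0"
  by (simp add: coeff_sum_def)

lemma coeff_sum_single: "coeff_sum F (Poly_Mapping.single m a) = (if m \<in> F then a else 0)"
  by (simp add: coeff_sum_def)

lemma coeff_sum_minus: "coeff_sum F (f - g) = coeff_sum F f - coeff_sum F g"
  using coeff_sum_add[of F "f - g" g] by simp

lemma coeff_sum_sum: "coeff_sum F (\<Sum>i\<in>S. f i) = (\<Sum>i\<in>S. coeff_sum F (f i))"
  by (induction S rule: infinite_finite_induct) (simp_all add: coeff_sum_add)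

lemma sum_of_terms:
  "f = (\<Sum>m\<in>Poly_Mapping.keys f. Poly_Mapping.single m (Poly_Mapping.lookup f m))"
  by (intro poly_mapping_eqI)
    (auto simp: lookup_sum lookup_single when_def in_keys_iff)

definition fibre :: "int^'n^'m \<Rightarrow> 'n expo \<Rightarrow> 'n expo set" where
  "fibre A m = {m'. expo_vec m' - expo_vec m \<in> kerZ A}"

lemma fibre_self: "m \<in> fibre A m"
  by (simp add: fibre_def kerZ_zero)

text \<open>
  A term times a toric binomial has its two monomials in the same fibre, with opposite
  coefficients.
\<close>

lemma coeff_sum_toric:
  fixes f :: "('n::finite, 'k::field) mpoly"
  assumes "f \<in> toric_ideal A"
  shows "coeff_sum (fibre A m) f = 0"
  using assms unfolding toric_ideal_def ideal_def
proof (induction rule: ring_module.span_induct_alt)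
  case (step c x y)
  then obtain u where u: "u \<in> kerZ A" "x = toric_binomial u" by blast
  have same: "q + pos_part u \<in> fibre A m \<longleftrightarrow> q + neg_part u \<in> fibre A m" for q
  proof -
    have "expo_vec (q + pos_part u) - expo_vec m = (expo_vec (q + neg_part u) - expo_vec m) + u"
      using expo_vec_parts[of u] by (simp add: expo_vec_add algebra_simps)
    then show ?thesis
      using kerZ_add[OF _ u(1)] kerZ_diff[OF _ u(1)] unfolding fibre_def mem_Collect_eq
      by (metis add_diff_cancel_right')
  qed
  have "coeff_sum (fibre A m) (Poly_Mapping.single q a * x) = 0" for q a
    by (simp add: u(2) toric_binomial_def monomial_def right_diff_distrib mult_single
        coeff_sum_minus coeff_sum_single same)
  then have "coeff_sum (fibre A m) (c * x) = 0"
    by (subst sum_of_terms[of c]) (simp add: sum_distrib_right coeff_sum_sum)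
  then show ?case using step.IH by (simp add: coeff_sum_add)
qed simp

lemma toric_binomial_in_ideal: "u \<in> kerZ A \<Longrightarrow> toric_binomial u \<in> toric_ideal A"
  unfolding toric_ideal_def by (intro ideal_base imageI)

text \<open>
  A single monomial cannot have fibre sum zero, so the support of an element of the ideal meets no
  fibre in exactly one monomial. Applied to leading monomials, this produces kernel vectors.
\<close>

lemma toric_fibre_partner:
  fixes f :: "('n::finite, 'k::field) mpoly"
  assumes f: "f \<in> toric_ideal A" and m: "m \<in> Poly_Mapping.keys f"
  obtains m' where "m' \<in> Poly_Mapping.keys f" "m' \<noteq> m" "expo_vec m - expo_vec m' \<in> kerZ A"
proof -
  have "\<exists>m'\<in>Poly_Mapping.keys f. m' \<noteq> m \<and> m' \<in> fibre A m"
  proof (rule ccontr)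
    assume "\<not> ?thesis"
    then have "coeff_sum (fibre A m) f =
        (\<Sum>m'\<in>Poly_Mapping.keys f. if m' = m then Poly_Mapping.lookup f m else 0)"
      unfolding coeff_sum_def using fibre_self by (intro sum.cong) auto
    also have "\<dots> = Poly_Mapping.lookup f m" using m by simp
    finally show False using coeff_sum_toric[OF f, of m] m by (simp add: in_keys_iff)
  qed
  then show ?thesis
    using that kerZ_uminus unfolding fibre_def by fastforce
qed

lemma keys_toric_binomial:
  "u \<noteq> 0 \<Longrightarrow>
   Poly_Mapping.keys (toric_binomial u :: ('n::finite, 'k::field) mpoly) = {pos_part u, neg_part u}"
  using parts_eq_iff[of u]
  by (auto simp: toric_binomial_def monomial_def in_keys_iff lookup_minus lookup_single when_def
      split: if_splits)

lemma toric_binomial_in_ideal_iff: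
  "(toric_binomial u :: ('n::finite, 'k::field) mpoly) \<in> toric_ideal A \<longleftrightarrow> u \<in> kerZ A"
proof
  assume *: "(toric_binomial u :: ('n, 'k) mpoly) \<in> toric_ideal A"
  show "u \<in> kerZ A"
  proof (cases "u = 0")
    case False
    obtain m' where "m' \<in> {pos_part u, neg_part u}" "m' \<noteq> pos_part u"
        "expo_vec (pos_part u) - expo_vec m' \<in> kerZ A"
      using toric_fibre_partner[OF *, of "pos_part u"] keys_toric_binomial[OF False] by auto
    then show ?thesis using expo_vec_parts[of u] by auto
  qed (simp add: kerZ_zero)
qed (rule toric_binomial_in_ideal)

text \<open>
  The toric ideal determines its lattice. This is what turns the equality between the bouquet ideal
  and the given simple toric ideal into an equality of kernels.
\<close>

lemma kerZ_eq_of_toric_ideal_eq: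
  assumes "(toric_ideal A :: ('n::finite, 'k::field) mpoly set) = toric_ideal A'"
  shows "kerZ A = kerZ A'"
proof (rule set_eqI)
  fix u
  have "u \<in> kerZ A \<longleftrightarrow> (toric_binomial u :: ('n, 'k) mpoly) \<in> toric_ideal A'"
    by (simp add: toric_binomial_in_ideal_iff flip: assms)
  then show "u \<in> kerZ A \<longleftrightarrow> u \<in> kerZ A'" by (simp add: toric_binomial_in_ideal_iff)
qed

text \<open>
  In characteristic two, opposite vectors have the same binomial; this is the only failure of
  injectivity.
\<close>

lemma toric_binomial_eq_iff:
  "(toric_binomial u :: ('n::finite, 'k::field) mpoly) = toric_binomial v \<longleftrightarrow>
     u = v \<or> (u = - v \<and> (-1 :: 'k) = 1)"
proof
  have eqI: "x = y" if "pos_part x = pos_part y" "neg_part x = neg_part y" for x y :: "int^'n"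
    using that expo_vec_parts by metis
  assume eq: "(toric_binomial u :: ('n, 'k) mpoly) = toric_binomial v"
  show "u = v \<or> (u = - v \<and> (-1 :: 'k) = 1)"
  proof (cases "u = 0 \<or> v = 0")
    case True
    have "x = 0" if "(toric_binomial x :: ('n, 'k) mpoly) = 0" for x
      using that keys_toric_binomial[of x, where 'k = 'k] by auto
    moreover have "(toric_binomial 0 :: ('n, 'k) mpoly) = 0"
      by (simp add: toric_binomial_def neg_part_eq)
    ultimately show ?thesis using True eq by metis
  next
    case False
    have lookup: "Poly_Mapping.lookup (toric_binomial x :: ('n, 'k) mpoly) (pos_part x) = 1"
      "Poly_Mapping.lookup (toric_binomial x :: ('n, 'k) mpoly) (neg_part x) = -1"
      if "x \<noteq> 0" for x
      using parts_eq_iff[of x] that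
      by (auto simp: toric_binomial_def monomial_def lookup_minus lookup_single when_def)
    have "{pos_part u, neg_part u} = {pos_part v, neg_part v}"
      using eq keys_toric_binomial[where 'k = 'k] False by metis
    then have "(pos_part u = pos_part v \<and> neg_part u = neg_part v) \<or>
       (pos_part u = neg_part v \<and> neg_part u = pos_part v)"
      by (simp add: doubleton_eq_iff)
    then show ?thesis
    proof
      assume *: "pos_part u = neg_part v \<and> neg_part u = pos_part v"
      then have "u = - v" using eqI[of u "- v"] by (simp add: neg_part_eq)
      moreover have "(-1 :: 'k) = 1" using lookup[of u] lookup[of v] False * eq by metis
      ultimately show ?thesis by blast
    qed (use eqI in blast)
  qed
next
  assume "u = v \<or> (u = - v \<and> (-1 :: 'k) = 1)"
  moreover have "(toric_binomial (- v) :: ('n, 'k) mpoly) = toric_binomial v" if "(-1 :: 'k) = 1"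
    using that
    by (intro poly_mapping_eqI) (simp add: toric_binomial_def monomial_def neg_part_eq
        lookup_minus lookup_single when_def)
  ultimately show "(toric_binomial u :: ('n, 'k) mpoly) = toric_binomial v" by auto
qed

section \<open>Reduced Groebner bases of toric ideals\<close>

definition positive_vectors :: "('n expo \<Rightarrow> 'n expo \<Rightarrow> bool) \<Rightarrow> int^'n^'m \<Rightarrow> (int^'n) set" where
  "positive_vectors lt A = {u \<in> kerZ A. order_pos lt u}"

text \<open>
  The positive kernel vectors whose leading monomial is a minimal generator of the initial ideal and
  whose other monomial is standard. Both conditions mention only the set of positive vectors and
  divisibility between parts of kernel vectors.
\<close>

definition reduced_vectors :: "('n expo \<Rightarrow> 'n expo \<Rightarrow> bool) \<Rightarrow> int^'n^'m \<Rightarrow> (int^'n) set" where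
  "reduced_vectors lt A = {u \<in> positive_vectors lt A. \<forall>v \<in> positive_vectors lt A.
     (expo_dvd (pos_part v) (pos_part u) \<longrightarrow> pos_part v = pos_part u) \<and>
     \<not> expo_dvd (pos_part v) (neg_part u)}"

lemma lead_toric_binomial:
  assumes "monomial_order lt" "order_pos lt u"
  shows "lead_expo lt (toric_binomial u :: ('n::finite, 'k::field) mpoly) = pos_part u"
proof -
  have "u \<noteq> 0" using assms order_pos_irrefl by blast
  then show ?thesis
    using assms keys_toric_binomial[of u, where 'k = 'k]
    by (intro lead_expo_eqI) (auto simp: order_pos_def)
qed

text \<open>
  The leading monomial shares its fibre with another, smaller monomial of the support; the difference
  of the two is a positive kernel vector, and its positive part divides the leading monomial.
\<close>

lemma toric_lead_dvd:
  fixes f :: "('n::finite, 'k::field) mpoly"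
  assumes lt: "monomial_order lt" and f: "f \<in> toric_ideal A" "f \<noteq> 0"
  shows "\<exists>v\<in>positive_vectors lt A. expo_dvd (pos_part v) (lead_expo lt f)"
proof -
  define m where "m = lead_expo lt f"
  obtain m' where m': "m' \<in> Poly_Mapping.keys f" "m' \<noteq> m" "expo_vec m - expo_vec m' \<in> kerZ A"
    using toric_fibre_partner[OF f(1), of m] lead_expo_in_keys[OF lt f(2)] m_def by auto
  then have "lt m' m" using lead_expo_greatest[OF lt f(2)] m_def by blast
  then have "expo_vec m - expo_vec m' \<in> positive_vectors lt A"
    using m' order_pos_diff_iff[OF lt] by (simp add: positive_vectors_def)
  then show ?thesis using pos_part_dvd m_def by blast
qed

lemma positive_binomial:
  assumes "monomial_order lt" "v \<in> positive_vectors lt A"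
  shows "(toric_binomial v :: ('n::finite, 'k::field) mpoly) \<in> toric_ideal A - {0}"
  using assms toric_binomial_in_ideal keys_toric_binomial[of v, where 'k = 'k] order_pos_irrefl
  by (fastforce simp: positive_vectors_def)

lemma initial_toric_ideal:
  assumes lt: "monomial_order lt"
  shows "(initial_ideal lt (toric_ideal A) :: ('n::finite, 'k::field) mpoly set) =
    ideal (monomial ` pos_part ` positive_vectors lt A)"
proof -
  define lead :: "('n, 'k) mpoly \<Rightarrow> _" where "lead = lead_expo lt"
  have "(initial_ideal lt (toric_ideal A) :: ('n, 'k) mpoly set) =
      ideal (monomial ` lead ` (toric_ideal A - {0}))"
    by (simp add: initial_ideal_def image_image lead_def)
  also have "\<dots> = ideal (monomial ` pos_part ` positive_vectors lt A)"
    unfolding monomial_ideal_eq_iff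
  proof (intro conjI ballI)
    fix s assume "s \<in> lead ` (toric_ideal A - {0})"
    then show "\<exists>s'\<in>pos_part ` positive_vectors lt A. expo_dvd s' s"
      using toric_lead_dvd[OF lt, where 'k = 'k] by (auto simp: lead_def)
  next
    fix s assume "s \<in> pos_part ` positive_vectors lt A"
    then obtain v where v: "v \<in> positive_vectors lt A" "s = pos_part v" by blast
    then have "lead (toric_binomial v) = s"
      by (simp add: lead_toric_binomial[OF lt] lead_def positive_vectors_def)
    then show "\<exists>s'\<in>lead ` (toric_ideal A - {0}). expo_dvd s' s"
      using positive_binomial[OF lt v(1), where 'k = 'k] by (metis expo_dvd_refl imageI)
  qed
  finally show ?thesis .
qed

text \<open>
  If two such binomials had equal leading monomials, the difference of their tails would be a kernel
  vector, positive up to sign, so the larger tail would not be standard.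
\<close>

lemma reduced_vectors_eqI:
  assumes lt: "monomial_order lt"
    and u: "u \<in> reduced_vectors lt A" and v: "v \<in> reduced_vectors lt A"
    and pos: "pos_part u = pos_part v"
  shows "u = v"
proof (rule ccontr)
  assume "u \<noteq> v"
  have False if x: "x \<in> reduced_vectors lt A" and y: "y \<in> reduced_vectors lt A"
    and eq: "pos_part x = pos_part y" and less: "order_pos lt (y - x)" for x y
  proof -
    have w: "y - x = expo_vec (neg_part x) - expo_vec (neg_part y)"
      using eq expo_vec_parts[of x] expo_vec_parts[of y] by (simp add: algebra_simps)
    have "y - x \<in> positive_vectors lt A"
      using x y less by (simp add: reduced_vectors_def positive_vectors_def kerZ_diff)
    then show False
      using pos_part_dvd[OF w] x by (auto simp: reduced_vectors_def)
  qed
  then show False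
    using order_pos_total[OF lt, of "u - v"] \<open>u \<noteq> v\<close> u v pos by fastforce
qed

text \<open>
  An element \<open>g\<close> of a reduced Groebner basis is a binomial: its leading monomial \<open>m\<close> has a partner
  \<open>m'\<close> in its fibre and in the support of \<open>g\<close>, and \<open>g\<close> minus the binomial of \<open>m\<close> and \<open>m'\<close> lies in
  the ideal although all its monomials are standard, so it vanishes. The finiteness of the set of
  reduced vectors and the fact that their leading monomials generate the initial ideal appear as
  explicit conditions, because in this form they pass from one ideal to the other along with the
  divisibility relation.
\<close>

lemma reduced_groebner_basis_toric_iff:
  fixes \<G> :: "('n::finite, 'k::field) mpoly set"
  assumes lt: "monomial_order lt"
  shows "reduced_groebner_basis lt (toric_ideal A) \<G> \<longleftrightarrow>
    finite (reduced_vectors lt A) \<and>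
    (\<forall>v\<in>positive_vectors lt A. \<exists>u\<in>reduced_vectors lt A. expo_dvd (pos_part u) (pos_part v)) \<and>
    \<G> = toric_binomial ` reduced_vectors lt A"
    (is "?L \<longleftrightarrow> ?fin \<and> ?cover \<and> ?eq")
proof -
  define lead :: "('n, 'k) mpoly \<Rightarrow> _" where "lead = lead_expo lt"
  note lead_key = lead_expo_in_keys[OF lt, where ?'a = 'k, folded lead_def]
  note lead_max = lead_expo_greatest[OF lt, where ?'a = 'k, folded lead_def]
  have lead_binomial: "lead (toric_binomial v) = pos_part v" if "v \<in> positive_vectors lt A" for v
    using that by (simp add: lead_toric_binomial[OF lt] lead_def positive_vectors_def)
  \<comment> \<open>The definition of reduced basis, with the equality of monomial ideals read as divisibility.\<close>
  have gb: "reduced_groebner_basis lt (toric_ideal A) \<G> \<longleftrightarrow>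
     finite \<G> \<and> \<G> \<subseteq> toric_ideal A \<and> 0 \<notin> \<G> \<and>
     (\<forall>v\<in>positive_vectors lt A. \<exists>g\<in>\<G>. expo_dvd (lead g) (pos_part v)) \<and>
     (\<forall>g\<in>\<G>. Poly_Mapping.lookup g (lead g) = 1) \<and>
     (\<forall>g\<in>\<G>. \<forall>h\<in>\<G>. g \<noteq> h \<longrightarrow> (\<forall>m\<in>Poly_Mapping.keys g. \<not> expo_dvd (lead h) m))"
    for \<G> :: "('n, 'k) mpoly set"
  proof -
    have init: "(initial_ideal lt (toric_ideal A) :: ('n, 'k) mpoly set) =
        ideal ((\<lambda>g. monomial (lead g)) ` \<G>) \<longleftrightarrow>
      (\<forall>v\<in>positive_vectors lt A. \<exists>g\<in>\<G>. expo_dvd (lead g) (pos_part v))"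
      if "\<G> \<subseteq> toric_ideal A" "0 \<notin> \<G>"
    proof -
      have leads: "(\<lambda>g. monomial (lead g) :: ('n, 'k) mpoly) ` \<G> = monomial ` lead ` \<G>"
        by (simp add: image_image)
      have "\<forall>s\<in>lead ` \<G>. \<exists>s'\<in>pos_part ` positive_vectors lt A. expo_dvd s' s"
        using that toric_lead_dvd[OF lt, where 'k = 'k, folded lead_def] by fastforce
      then show ?thesis
        unfolding initial_toric_ideal[OF lt] leads monomial_ideal_eq_iff by auto
    qed
    show ?thesis
    proof (cases "\<G> \<subseteq> toric_ideal A \<and> 0 \<notin> \<G>")
      case True
      then show ?thesis
        unfolding reduced_groebner_basis_def groebner_basis_def expo_dvd_iff[symmetric]
          lead_def[symmetric]
        by (simp add: init)
    qed (auto simp: reduced_groebner_basis_def groebner_basis_def)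
  qed
  show ?thesis
  proof
    assume ?L
    then have fin: "finite \<G>" and sub: "\<G> \<subseteq> toric_ideal A" and nz: "0 \<notin> \<G>"
      and cover: "\<And>v. v \<in> positive_vectors lt A \<Longrightarrow> \<exists>g\<in>\<G>. expo_dvd (lead g) (pos_part v)"
      and monic: "\<And>g. g \<in> \<G> \<Longrightarrow> Poly_Mapping.lookup g (lead g) = 1"
      and red: "\<And>g h m. g \<in> \<G> \<Longrightarrow> h \<in> \<G> \<Longrightarrow> g \<noteq> h \<Longrightarrow> m \<in> Poly_Mapping.keys g \<Longrightarrow>
         \<not> expo_dvd (lead h) m"
      unfolding gb by simp_all
    \<comment> \<open>A leading monomial dividing a tail monomial of \<open>g\<close> can, by reducedness, only be that of \<open>g\<close> itself,
      which is too large.\<close>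
    have tail: "\<not> expo_dvd (pos_part v) m"
      if g: "g \<in> \<G>" and m: "m \<in> Poly_Mapping.keys g" "m \<noteq> lead g"
        and v: "v \<in> positive_vectors lt A" for g m v
    proof
      assume dvd: "expo_dvd (pos_part v) m"
      obtain h where h: "h \<in> \<G>" "expo_dvd (lead h) (pos_part v)"
        using cover[OF v] by blast
      have hm: "expo_dvd (lead h) m" by (rule expo_dvd_trans[OF h(2) dvd])
      have "h = g" using red[OF g h(1) _ m(1)] hm by metis
      then have "lt (lead g) m" using order_dvd[OF lt hm] m(2) by simp
      moreover have "lt m (lead g)" using lead_max[OF _ m] g nz by metis
      ultimately show False using order_trans[OF lt, of m "lead g" m] order_irrefl[OF lt] by simp
    qed
    have rep: "\<exists>u\<in>reduced_vectors lt A. g = toric_binomial u" if g: "g \<in> \<G>" for g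
    proof -
      have g0: "g \<noteq> 0" and gI: "g \<in> toric_ideal A" using g nz sub by auto
      obtain m' where m': "m' \<in> Poly_Mapping.keys g" "m' \<noteq> lead g"
          "expo_vec (lead g) - expo_vec m' \<in> kerZ A"
        using toric_fibre_partner[OF gI lead_key[OF g0]] .
      define u where "u = expo_vec (lead g) - expo_vec m'"
      have "lt m' (lead g)" by (rule lead_max[OF g0 m'(1,2)])
      then have u: "u \<in> positive_vectors lt A"
        using m' order_pos_diff_iff[OF lt] by (simp add: positive_vectors_def u_def)
      have min: "pos_part v = lead g"
        if v: "v \<in> positive_vectors lt A" and dvd: "expo_dvd (pos_part v) (lead g)" for v
      proof -
        obtain h where h: "h \<in> \<G>" "expo_dvd (lead h) (pos_part v)" using cover[OF v] by blast
        have "expo_dvd (lead h) (lead g)" by (rule expo_dvd_trans[OF h(2) dvd])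
        then have "h = g" using red[OF g h(1) _ lead_key[OF g0]] by metis
        then show ?thesis using expo_dvd_antisym[OF dvd] h(2) by simp
      qed
      have pos: "pos_part u = lead g"
        by (rule min[OF u pos_part_dvd[OF u_def]])
      have "lead g + neg_part u = lead g + m'"
        using expo_exchange[of "lead g" m', folded u_def] pos by (simp add: add.commute)
      then have neg: "neg_part u = m'" by simp
      have "u \<in> reduced_vectors lt A"
        using u min tail[OF g m'(1,2)] by (auto simp: reduced_vectors_def pos neg)
      moreover have "g - toric_binomial u = 0"
      proof (rule ccontr)
        let ?d = "g - toric_binomial u"
        assume d0: "?d \<noteq> 0"
        have "?d \<in> toric_ideal A"
          using gI toric_binomial_in_ideal[of u A] u unfolding toric_ideal_def positive_vectors_def
          by (intro ideal_diff) auto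
        then obtain v where v: "v \<in> positive_vectors lt A" "expo_dvd (pos_part v) (lead ?d)"
          using toric_lead_dvd[OF lt _ d0] unfolding lead_def by metis
        have "u \<noteq> 0" using u order_pos_irrefl[OF lt] by (auto simp: positive_vectors_def)
        then have nlead: "lead g \<notin> Poly_Mapping.keys ?d"
          using monic[OF g] pos parts_eq_iff[of u]
          by (simp add: in_keys_iff lookup_minus toric_binomial_def monomial_def lookup_single)
        have "Poly_Mapping.keys ?d \<subseteq>
            Poly_Mapping.keys g \<union> Poly_Mapping.keys (toric_binomial u :: ('n, 'k) mpoly)"
          by (rule keys_diff)
        also have "\<dots> = Poly_Mapping.keys g"
          using keys_toric_binomial[OF \<open>u \<noteq> 0\<close>, where 'k = 'k] pos neg m' lead_key[OF g0] by auto
        finally have "lead ?d \<in> Poly_Mapping.keys g" "lead ?d \<noteq> lead g"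
          using lead_key[OF d0] nlead by auto
        then show False using tail[OF g _ _ v(1)] v(2) by simp
      qed
      ultimately show ?thesis by auto
    qed
    have inj: "inj_on (toric_binomial :: _ \<Rightarrow> ('n, 'k) mpoly) (reduced_vectors lt A)"
    proof (rule inj_onI)
      fix u v assume "u \<in> reduced_vectors lt A" "v \<in> reduced_vectors lt A"
        "(toric_binomial u :: ('n, 'k) mpoly) = toric_binomial v"
      then show "u = v"
        using order_pos_asym[OF lt, of v]
        by (auto simp: toric_binomial_eq_iff reduced_vectors_def positive_vectors_def)
    qed
    have "toric_binomial u \<in> \<G>" if u: "u \<in> reduced_vectors lt A" for u
    proof -
      have uP: "u \<in> positive_vectors lt A" using u by (simp add: reduced_vectors_def)
      obtain g where g: "g \<in> \<G>" "expo_dvd (lead g) (pos_part u)" using cover uP by blast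
      obtain v where v: "v \<in> reduced_vectors lt A" "g = toric_binomial v" using rep[OF g(1)] by blast
      have vP: "v \<in> positive_vectors lt A" using v by (simp add: reduced_vectors_def)
      then have "pos_part v = pos_part u"
        using u g v lead_binomial by (simp add: reduced_vectors_def)
      then have "v = u" by (rule reduced_vectors_eqI[OF lt v(1) u])
      then show ?thesis using g v by simp
    qed
    then have eq: ?eq using rep by blast
    moreover have ?fin by (rule finite_imageD[OF fin[unfolded eq] inj])
    moreover have ?cover
    proof
      fix v assume "v \<in> positive_vectors lt A"
      then obtain g where g: "g \<in> \<G>" "expo_dvd (lead g) (pos_part v)" using cover by blast
      obtain u where u: "u \<in> reduced_vectors lt A" "g = toric_binomial u" using rep[OF g(1)] by blast
      then have "lead g = pos_part u" using lead_binomial by (simp add: reduced_vectors_def)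
      then show "\<exists>u\<in>reduced_vectors lt A. expo_dvd (pos_part u) (pos_part v)"
        using u g by auto
    qed
    ultimately show "?fin \<and> ?cover \<and> ?eq" by blast
  next
    assume "?fin \<and> ?cover \<and> ?eq"
    then have fin: ?fin and cover: ?cover and eq: ?eq by iprover+
    have RP: "u \<in> positive_vectors lt A" if "u \<in> reduced_vectors lt A" for u
      using that by (simp add: reduced_vectors_def)
    have rep: "\<exists>u\<in>reduced_vectors lt A. g = toric_binomial u" if "g \<in> \<G>" for g
      using that by (auto simp: eq)
    have in_ideal: "g \<in> toric_ideal A - {0}" if g: "g \<in> \<G>" for g
    proof -
      obtain u where u: "u \<in> reduced_vectors lt A" "g = toric_binomial u" using rep[OF g] by blast
      show ?thesis unfolding u(2) by (rule positive_binomial[OF lt RP[OF u(1)]])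
    qed
    show ?L
      unfolding gb
    proof (intro conjI ballI impI)
      show "finite \<G>" using fin by (simp add: eq)
      show "\<G> \<subseteq> toric_ideal A" "0 \<notin> \<G>"
        using in_ideal by auto
      show "\<exists>g\<in>\<G>. expo_dvd (lead g) (pos_part v)" if v: "v \<in> positive_vectors lt A" for v
      proof -
        obtain u where u: "u \<in> reduced_vectors lt A" "expo_dvd (pos_part u) (pos_part v)"
          using bspec[OF cover v] by blast
        have "toric_binomial u \<in> \<G>" using u(1) by (simp add: eq)
        then show ?thesis using u(2) lead_binomial[OF RP[OF u(1)]] by (intro bexI) simp_all
      qed
      show "Poly_Mapping.lookup g (lead g) = 1" if g: "g \<in> \<G>" for g
      proof -
        obtain u where u: "u \<in> reduced_vectors lt A" "g = toric_binomial u" using rep[OF g] by blast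
        then have "u \<noteq> 0"
          using RP[OF u(1)] order_pos_irrefl[OF lt] by (auto simp: positive_vectors_def)
        then show ?thesis
          using u lead_binomial[OF RP[OF u(1)]] parts_eq_iff[of u]
          by (simp add: toric_binomial_def monomial_def lookup_minus lookup_single)
      qed
      show "\<not> expo_dvd (lead h) m"
        if g: "g \<in> \<G>" and h: "h \<in> \<G>" "g \<noteq> h" and m: "m \<in> Poly_Mapping.keys g" for g h m
      proof
        assume dvd: "expo_dvd (lead h) m"
        obtain u v where u: "u \<in> reduced_vectors lt A" "g = toric_binomial u"
          and v: "v \<in> reduced_vectors lt A" "h = toric_binomial v" using rep[OF g] rep[OF h(1)] by blast
        have "u \<noteq> 0" using RP[OF u(1)] order_pos_irrefl[OF lt] by (auto simp: positive_vectors_def)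
        then have "m = pos_part u \<or> m = neg_part u"
          using m u keys_toric_binomial[of u, where 'k = 'k] by auto
        moreover have "expo_dvd (pos_part v) m" using dvd v lead_binomial[OF RP[OF v(1)]] by simp
        ultimately have "pos_part v = pos_part u"
          using u(1) RP[OF v(1)] by (auto simp: reduced_vectors_def)
        then show False using reduced_vectors_eqI[OF lt v(1) u(1)] u v h(2) by simp
      qed
    qed
  qed
qed

section \<open>Bouquet decompositions\<close>

text \<open>
  Adjacency in the bouquet graph is, up to reflexivity, already an equivalence relation, so the
  connected components are its classes. Asking for one nonzero factor also covers the pair of two
  zero rows and excludes a zero row paired with a nonzero one.
\<close>

definition proportional_rows :: "(int^'n) list \<Rightarrow> 'n \<Rightarrow> 'n \<Rightarrow> bool" where
  "proportional_rows G i j \<longleftrightarrow> (\<exists>q. q \<noteq> 0 \<and> is_multiple q (gale_row G i) (gale_row G j))"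

lemma is_multiple_gale_row_iff:
  "is_multiple q (gale_row G i) (gale_row G j) \<longleftrightarrow>
     (\<forall>g\<in>set G. rat_of_int (g $ i) = q * rat_of_int (g $ j))"
  by (simp add: is_multiple_def gale_row_def)

lemma proportional_rows_iff:
  "proportional_rows G i j \<longleftrightarrow>
     (\<exists>q. is_multiple q (gale_row G i) (gale_row G j)) \<and>
     (\<exists>q. is_multiple q (gale_row G j) (gale_row G i))"
proof (intro iffI conjI)
  assume "proportional_rows G i j"
  then obtain q where q: "q \<noteq> 0" "is_multiple q (gale_row G i) (gale_row G j)"
    by (auto simp: proportional_rows_def)
  then show "\<exists>q. is_multiple q (gale_row G i) (gale_row G j)" by blast
  have "is_multiple (1 / q) (gale_row G j) (gale_row G i)"
    using q by (simp add: is_multiple_gale_row_iff)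
  then show "\<exists>q. is_multiple q (gale_row G j) (gale_row G i)" by blast
next
  assume "(\<exists>q. is_multiple q (gale_row G i) (gale_row G j)) \<and>
     (\<exists>q. is_multiple q (gale_row G j) (gale_row G i))"
  then obtain q q' where q: "is_multiple q (gale_row G i) (gale_row G j)"
    and q': "is_multiple q' (gale_row G j) (gale_row G i)" by blast
  have "is_multiple 1 (gale_row G i) (gale_row G j)" if "q = 0"
    using q q' that by (simp add: is_multiple_gale_row_iff)
  then show "proportional_rows G i j"
    unfolding proportional_rows_def using q one_neq_zero by metis
qed

lemma proportional_rows_refl: "proportional_rows G i i"
  unfolding proportional_rows_def by (intro exI[of _ 1]) (simp add: is_multiple_gale_row_iff)

lemma proportional_rows_sym: "proportional_rows G i j \<Longrightarrow> proportional_rows G j i"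
  by (simp add: proportional_rows_iff)

lemma proportional_rows_trans:
  assumes "proportional_rows G i j" "proportional_rows G j k"
  shows "proportional_rows G i k"
proof -
  obtain p where p: "p \<noteq> 0" "is_multiple p (gale_row G i) (gale_row G j)"
    using assms(1) unfolding proportional_rows_def by blast
  obtain q where q: "q \<noteq> 0" "is_multiple q (gale_row G j) (gale_row G k)"
    using assms(2) unfolding proportional_rows_def by blast
  have "is_multiple (p * q) (gale_row G i) (gale_row G k)"
    using p(2) q(2) unfolding is_multiple_gale_row_iff by (metis mult.assoc)
  then show ?thesis unfolding proportional_rows_def using p(1) q(1) by (metis mult_eq_0_iff)
qed

lemma bouquet_edge_iff: "bouquet_edge G i j \<longleftrightarrow> i \<noteq> j \<and> proportional_rows G i j"
  by (simp add: bouquet_edge_def proportional_rows_iff)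

lemma bouquet_connected_iff: "(bouquet_edge G)\<^sup>*\<^sup>* i j \<longleftrightarrow> proportional_rows G i j"
proof
  show "proportional_rows G i j" if "(bouquet_edge G)\<^sup>*\<^sup>* i j"
    using that
  proof induction
    case (step j k)
    then show ?case using proportional_rows_trans[of G i j k] by (simp add: bouquet_edge_iff)
  qed (rule proportional_rows_refl)
  show "(bouquet_edge G)\<^sup>*\<^sup>* i j" if "proportional_rows G i j"
    using that by (cases "i = j") (auto simp: bouquet_edge_iff)
qed

lemma bouquets_eq: "bouquets G = range (\<lambda>i. {j. proportional_rows G i j})"
  by (simp add: bouquets_def bouquet_connected_iff)

lemma nat_scale_le_iff:
  fixes a b c :: int
  shows "c > 0 \<Longrightarrow> nat (a * c) \<le> nat (b * c) \<longleftrightarrow> nat a \<le> nat b"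
    and "c < 0 \<Longrightarrow> nat (a * c) \<le> nat (b * c) \<longleftrightarrow> nat (- a) \<le> nat (- b)"
proof -
  have *: "nat (a * c) \<le> nat (b * c) \<longleftrightarrow> nat a \<le> nat b" if "c > 0" for a b c :: int
    using that nat_mult_distrib[of c a] nat_mult_distrib[of c b] by (simp add: mult.commute)
  show "c > 0 \<Longrightarrow> nat (a * c) \<le> nat (b * c) \<longleftrightarrow> nat a \<le> nat b" by (rule *)
  show "c < 0 \<Longrightarrow> nat (a * c) \<le> nat (b * c) \<longleftrightarrow> nat (- a) \<le> nat (- b)"
    using *[of "- c" "- a" "- b"] by simp
qed

locale bouquet_decomposition =
  fixes A :: "int^'n^'m" and G :: "(int^'n) list" and B :: "'s::finite \<Rightarrow> 'n set"
    and f :: "'s \<Rightarrow> 'n" and c :: "'s \<Rightarrow> int^'n"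
  assumes bouquet_data: "bouquet_structure A G B f c"
begin

lemma kerZ_eq_span: "kerZ A = int_vec.span (set G)"
  using bouquet_data by (simp add: bouquet_structure_def gale_transform_def)

lemma first_in: "f i \<in> B i"
  using bouquet_data by (simp add: bouquet_structure_def)

lemma vector: "bouquet_vector G (B i) (f i) (c i)"
  using bouquet_data by (simp add: bouquet_structure_def)

lemma bouquet_proportional: "j \<in> B i \<Longrightarrow> k \<in> B i \<Longrightarrow> proportional_rows G j k"
proof -
  assume jk: "j \<in> B i" "k \<in> B i"
  have "B i \<in> bouquets G"
    using bouquet_data bij_betwE unfolding bouquet_structure_def by blast
  then obtain r where "B i = {j. proportional_rows G r j}" by (auto simp: bouquets_eq)
  then show ?thesis
    using jk proportional_rows_sym[of G r j] proportional_rows_trans[of G j r k] by simp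
qed

lemma bouquets_partition: "\<exists>!i. j \<in> B i"
proof -
  have bij: "bij_betw B UNIV (bouquets G)" using bouquet_data by (simp add: bouquet_structure_def)
  have "{k. proportional_rows G j k} \<in> bouquets G" by (auto simp: bouquets_eq)
  then obtain i where i: "B i = {k. proportional_rows G j k}"
    using bij by (metis (no_types, lifting) bij_betw_imp_surj_on imageE)
  have eq: "B i' = B i" if "j \<in> B i'" for i'
  proof -
    have "B i' \<in> bouquets G" using bij bij_betwE by blast
    then obtain r where r: "B i' = {k. proportional_rows G r k}" by (auto simp: bouquets_eq)
    then have "proportional_rows G r j" using that by simp
    then show ?thesis
      unfolding i r
      using proportional_rows_sym[of G r j] proportional_rows_trans[of G r j]
        proportional_rows_trans[of G j r] by auto
  qed
  have "j \<in> B i" by (simp add: i proportional_rows_refl)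
  then show ?thesis
  proof (rule ex1I[of _ i])
    fix i' assume "j \<in> B i'"
    then show "i' = i" by (rule injD[OF bij_betw_imp_inj_on[OF bij] eq])
  qed
qed

text \<open>
  A linear relation between two rows of the Gale transform holds for the columns, hence for the lattice
  that they span.
\<close>

lemma kerZ_multiple:
  assumes "v \<in> kerZ A" "is_multiple q (gale_row G i) (gale_row G j)"
  shows "rat_of_int (v $ i) = q * rat_of_int (v $ j)"
  using assms(1) unfolding kerZ_eq_span
proof (induction rule: int_vec.span_induct_alt)
  case (step a x y)
  have "rat_of_int (x $ i) = q * rat_of_int (x $ j)"
    using step.hyps assms(2) unfolding is_multiple_gale_row_iff by blast
  then show ?case using step.IH by (simp add: distrib_left)
qed simp

lemma kerZ_free:
  assumes "v \<in> kerZ A" "free_vector G i"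
  shows "v $ i = 0"
  using assms(1) unfolding kerZ_eq_span
proof (induction rule: int_vec.span_induct_alt)
  case (step a x y)
  then show ?case using assms(2) by (simp add: free_vector_def gale_row_def)
qed simp

text \<open>
  The vector of a non-free bouquet is the primitive integer vector on the line spanned by the
  restriction of any kernel vector \<open>w\<close> that does not vanish there.
\<close>

lemma bouquet_vector_nonfree:
  assumes "\<not> free_bouquet G (B i)"
  obtains w d where "w \<in> kerZ A" "d \<noteq> 0" "\<And>j. j \<in> B i \<Longrightarrow> w $ j = d * c i $ j"
    "\<And>j. j \<in> B i \<Longrightarrow> c i $ j \<noteq> 0" "c i $ f i > 0" "Gcd ((\<lambda>j. c i $ j) ` B i) = 1"
proof -
  obtain l where l: "l < length G" and nz: "\<And>j. j \<in> B i \<Longrightarrow> G ! l $ j \<noteq> 0"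
    and c: "\<And>j. j \<in> B i \<Longrightarrow> c i $ j =
      sgn (G ! l $ f i) * (G ! l $ j) div Gcd ((\<lambda>j. G ! l $ j) ` B i)"
    using vector[of i] assms unfolding bouquet_vector_def by auto
  define w where "w = G ! l"
  define g where "g = Gcd ((\<lambda>j. w $ j) ` B i)"
  define s where "s = sgn (w $ f i)"
  have wf: "w $ f i \<noteq> 0" using nz[OF first_in] by (simp add: w_def)
  have s: "s * s = 1" "s * w $ f i = \<bar>w $ f i\<bar>"
    using wf by (auto simp: s_def sgn_if)
  have "g \<noteq> 0" using wf first_in by (auto simp: g_def)
  then have "g > 0" by (simp add: g_def order_less_le)
  have sc: "s * w $ j = g * c i $ j" if "j \<in> B i" for j
  proof -
    have "g dvd s * w $ j" unfolding g_def using that by (intro dvd_mult Gcd_dvd imageI)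
    then show ?thesis using c[OF that] by (simp add: w_def g_def s_def)
  qed
  have wc: "w $ j = s * g * c i $ j" if "j \<in> B i" for j
  proof -
    have "w $ j = s * (s * w $ j)" using s(1) by (simp add: mult.assoc[symmetric])
    then show ?thesis using sc[OF that] by simp
  qed
  have "w \<in> kerZ A"
    unfolding kerZ_eq_span w_def using l by (intro int_vec.span_base) simp
  moreover have "s * g \<noteq> 0" using s(1) \<open>g \<noteq> 0\<close> by auto
  moreover have "c i $ j \<noteq> 0" if "j \<in> B i" for j
    using wc[OF that] nz[OF that] by (auto simp: w_def)
  moreover have "c i $ f i > 0"
  proof -
    have "g * c i $ f i > 0" using sc[OF first_in] s(2) wf by simp
    then show ?thesis using \<open>g > 0\<close> by (simp add: zero_less_mult_iff)
  qed
  moreover have "Gcd ((\<lambda>j. c i $ j) ` B i) = 1"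
  proof -
    have "(\<lambda>j. s * w $ j) ` B i = (*) s ` (\<lambda>j. w $ j) ` B i" by (simp add: image_image)
    then have "Gcd ((\<lambda>j. s * w $ j) ` B i) = \<bar>s * g\<bar>"
      by (simp only: Gcd_mult normalize_int_def g_def)
    also have "\<dots> = g" using \<open>g > 0\<close> wf by (simp add: s_def abs_mult abs_sgn_eq)
    finally have "Gcd ((\<lambda>j. s * w $ j) ` B i) = g" .
    moreover have "(\<lambda>j. s * w $ j) ` B i = (*) g ` (\<lambda>j. c i $ j) ` B i"
      using sc by (auto simp: image_image)
    ultimately have "g = \<bar>g * Gcd ((\<lambda>j. c i $ j) ` B i)\<bar>"
      by (simp only: Gcd_mult normalize_int_def)
    then show ?thesis using \<open>g > 0\<close> by (simp add: abs_mult)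
  qed
  ultimately show ?thesis using that wc by blast
qed

lemma bouquet_coordinate_nonzero: "j \<in> B i \<Longrightarrow> c i $ j \<noteq> 0"
  using vector[of i] bouquet_vector_nonfree[of i]
  by (cases "free_bouquet G (B i)") (metis bouquet_vector_def)+

text \<open>
  On a bouquet all kernel vectors are proportional to the primitive vector \<open>c i\<close>, and primitivity makes
  the factor an integer: the first coordinate of \<open>c i\<close> divides every \<open>v $ f i * c i $ j\<close>, hence their
  gcd, which is \<open>v $ f i\<close> up to sign.
\<close>

lemma kerZ_on_bouquet:
  assumes v: "v \<in> kerZ A"
  shows "\<exists>t. \<forall>j\<in>B i. v $ j = t * c i $ j"
proof (cases "free_bouquet G (B i)")
  case True
  then show ?thesis
    using kerZ_free[OF v] by (intro exI[of _ 0]) (simp add: free_bouquet_def)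
next
  case False
  then obtain w d where w: "w \<in> kerZ A" "d \<noteq> 0" "\<And>j. j \<in> B i \<Longrightarrow> w $ j = d * c i $ j"
    and nz: "\<And>j. j \<in> B i \<Longrightarrow> c i $ j \<noteq> 0" and gcd: "Gcd ((\<lambda>j. c i $ j) ` B i) = 1"
    by (rule bouquet_vector_nonfree) blast
  have cross: "v $ j * c i $ f i = v $ f i * c i $ j" if j: "j \<in> B i" for j
  proof -
    obtain q where q: "is_multiple q (gale_row G j) (gale_row G (f i))"
      using bouquet_proportional[OF j first_in] by (auto simp: proportional_rows_def)
    have "rat_of_int (v $ j * w $ f i) = rat_of_int (v $ f i * w $ j)"
      using kerZ_multiple[OF v q] kerZ_multiple[OF w(1) q] by simp
    then have "v $ j * w $ f i = v $ f i * w $ j" by (simp only: of_int_eq_iff)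
    then show ?thesis using w j first_in by simp
  qed
  have "c i $ f i dvd Gcd ((*) (v $ f i) ` (\<lambda>j. c i $ j) ` B i)"
  proof (rule Gcd_greatest)
    fix x assume "x \<in> (*) (v $ f i) ` (\<lambda>j. c i $ j) ` B i"
    then obtain j where j: "j \<in> B i" "x = v $ f i * c i $ j" by blast
    show "c i $ f i dvd x" unfolding j(2) cross[OF j(1), symmetric] by simp
  qed
  then have "c i $ f i dvd v $ f i" by (simp only: Gcd_mult gcd) simp
  then obtain t where t: "v $ f i = c i $ f i * t" unfolding dvd_def by blast
  have "v $ j = t * c i $ j" if "j \<in> B i" for j
  proof -
    have "v $ j * c i $ f i = (t * c i $ j) * c i $ f i"
      unfolding cross[OF that] t by (simp only: ac_simps)
    then show ?thesis using nz[OF first_in] by simp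
  qed
  then show ?thesis by blast
qed

lemma bouquet_map_nth:
  assumes "j \<in> B i"
  shows "bouquet_map c u $ j = u $ i * c i $ j"
proof -
  have zero: "c i' $ j = 0" if "i' \<noteq> i" for i'
    using vector[of i'] bouquets_partition[of j] that assms unfolding bouquet_vector_def by metis
  have "bouquet_map c u $ j = (\<Sum>i'\<in>UNIV. u $ i' * c i' $ j)"
    by (simp add: bouquet_map_def)
  also have "\<dots> = (\<Sum>i'\<in>UNIV. if i' = i then u $ i * c i $ j else 0)"
    by (intro sum.cong) (simp_all add: zero)
  finally show ?thesis by simp
qed

lemma bouquet_map_in_kerZ_iff: "bouquet_map c u \<in> kerZ A \<longleftrightarrow> u \<in> kerZ (bouquet_matrix A c)"
proof -
  have "A *v bouquet_map c u = bouquet_matrix A c *v u"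
  proof (subst vec_eq_iff, intro allI)
    fix k
    have "(A *v bouquet_map c u) $ k = (\<Sum>j\<in>UNIV. \<Sum>i\<in>UNIV. A $ k $ j * (u $ i * c i $ j))"
      by (simp add: matrix_vector_mult_def bouquet_map_def sum_component sum_distrib_left)
    also have "\<dots> = (\<Sum>i\<in>UNIV. \<Sum>j\<in>UNIV. A $ k $ j * (u $ i * c i $ j))" by (rule sum.swap)
    also have "\<dots> = (\<Sum>i\<in>UNIV. (\<Sum>j\<in>UNIV. A $ k $ j * c i $ j) * u $ i)"
      unfolding sum_distrib_right by (intro sum.cong refl) (simp only: mult_ac)
    also have "\<dots> = (bouquet_matrix A c *v u) $ k"
      by (simp add: matrix_vector_mult_def bouquet_matrix_def)
    finally show "(A *v bouquet_map c u) $ k = (bouquet_matrix A c *v u) $ k" .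
  qed
  then show ?thesis by (simp add: kerZ_def)
qed

text \<open>
  The vectors \<open>c i\<close> have disjoint supports, so the map is injective; it is onto because a kernel
  vector is an integer multiple of \<open>c i\<close> on each bouquet.
\<close>

lemma bouquet_map_bij: "bij_betw (bouquet_map c) (kerZ (bouquet_matrix A c)) (kerZ A)"
proof (rule bij_betwI')
  show "bouquet_map c u = bouquet_map c v \<longleftrightarrow> u = v" for u v
  proof
    assume eq: "bouquet_map c u = bouquet_map c v"
    have "u $ i = v $ i" for i
    proof -
      have "u $ i * c i $ f i = v $ i * c i $ f i"
        using eq bouquet_map_nth[OF first_in] by metis
      then show ?thesis using bouquet_coordinate_nonzero[OF first_in] by simp
    qed
    then show "u = v" by (simp add: vec_eq_iff)
  qed simp
  show "bouquet_map c u \<in> kerZ A" if "u \<in> kerZ (bouquet_matrix A c)" for u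
    using that by (simp add: bouquet_map_in_kerZ_iff)
  fix v assume v: "v \<in> kerZ A"
  obtain t where t: "\<And>i j. j \<in> B i \<Longrightarrow> v $ j = t i * c i $ j"
    using kerZ_on_bouquet[OF v] by metis
  have "bouquet_map c (\<chi> i. t i) $ j = v $ j" for j
  proof -
    obtain i where "j \<in> B i" using bouquets_partition by blast
    then show ?thesis using bouquet_map_nth t by simp
  qed
  then have "v = bouquet_map c (\<chi> i. t i)" by (simp add: vec_eq_iff)
  then show "\<exists>u\<in>kerZ (bouquet_matrix A c). v = bouquet_map c u"
    using v bouquet_map_in_kerZ_iff by metis
qed

lemma bouquet_map_add: "bouquet_map c (u + v) = bouquet_map c u + bouquet_map c v"
  by (simp add: bouquet_map_def vector_sadd_rdistrib sum.distrib)

lemma free_coordinate_zero: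
  assumes "u \<in> kerZ (bouquet_matrix A c)" "free_bouquet G (B i)"
  shows "u $ i = 0"
proof -
  have "bouquet_map c u $ f i = 0"
    using assms first_in by (intro kerZ_free) (simp_all add: bouquet_map_in_kerZ_iff free_bouquet_def)
  then show ?thesis using bouquet_map_nth[OF first_in] bouquet_coordinate_nonzero[OF first_in] by simp
qed

lemma multiple_coordinates:
  assumes "\<not> free_bouquet G (B i)" "j \<in> B i" "k \<in> B i"
    and "is_multiple q (gale_row G j) (gale_row G k)"
  shows "rat_of_int (c i $ j) = q * rat_of_int (c i $ k)"
proof -
  obtain w d where w: "w \<in> kerZ A" "d \<noteq> 0" "\<And>j. j \<in> B i \<Longrightarrow> w $ j = d * c i $ j"
    using bouquet_vector_nonfree[OF assms(1)] by metis
  have "rat_of_int (w $ j) = q * rat_of_int (w $ k)" by (rule kerZ_multiple[OF w(1) assms(4)])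
  then show ?thesis using w assms by simp
qed

text \<open>
  The factor between two rows is also the factor between the corresponding coordinates of \<open>c i\<close>, and
  the coordinate at the first element is positive.
\<close>

lemma non_mixed_signs:
  assumes "non_mixed_bouquet G (B i)" "j \<in> B i"
  shows "c i $ j > 0"
proof -
  have nonfree: "\<not> free_bouquet G (B i)" and unmixed: "\<not> mixed_bouquet G (B i)"
    using assms by (simp_all add: non_mixed_bouquet_def)
  obtain q where q: "q \<noteq> 0" "is_multiple q (gale_row G j) (gale_row G (f i))"
    using bouquet_proportional[OF assms(2) first_in] by (auto simp: proportional_rows_def)
  have cf: "c i $ f i > 0" using bouquet_vector_nonfree[OF nonfree] by metis
  have cj: "rat_of_int (c i $ j) = q * rat_of_int (c i $ f i)"
    by (rule multiple_coordinates[OF nonfree assms(2) first_in q(2)])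
  have "\<not> q < 0"
  proof
    assume "q < 0"
    then have "c i $ j \<noteq> c i $ f i" using cj cf by auto
    then have "bouquet_edge G j (f i)"
      using bouquet_proportional[OF assms(2) first_in] by (auto simp: bouquet_edge_iff)
    then show False
      using unmixed nonfree assms(2) first_in q(2) \<open>q < 0\<close> unfolding mixed_bouquet_def by blast
  qed
  then have "q > 0" using q by simp
  then have "rat_of_int (c i $ j) > 0" using cj cf by simp
  then show ?thesis by simp
qed

lemma mixed_signs:
  assumes "mixed_bouquet G (B i)"
  obtains j k where "j \<in> B i" "k \<in> B i" "c i $ j > 0" "c i $ k < 0"
proof -
  have nonfree: "\<not> free_bouquet G (B i)" using assms by (simp add: mixed_bouquet_def)
  obtain j k q where jk: "j \<in> B i" "k \<in> B i" and q: "q < 0"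
    "is_multiple q (gale_row G j) (gale_row G k)"
    using assms unfolding mixed_bouquet_def by blast
  have cj: "rat_of_int (c i $ j) = q * rat_of_int (c i $ k)"
    by (rule multiple_coordinates[OF nonfree jk q(2)])
  show ?thesis
  proof (cases "c i $ k > 0")
    case True
    then have "rat_of_int (c i $ j) < 0" using cj q by (simp add: mult_neg_pos)
    then show ?thesis using that[of k j] jk True by simp
  next
    case False
    then have "c i $ k < 0" using bouquet_coordinate_nonzero[OF jk(2)] by simp
    then have "rat_of_int (c i $ j) > 0" using cj q by (simp add: mult_neg_neg)
    then show ?thesis using that[of j k] jk \<open>c i $ k < 0\<close> by simp
  qed
qed

text \<open>
  In a non-mixed bouquet all coordinates of \<open>c i\<close> are positive, so the positive part of an image only
  sees the positive part of the coordinate \<open>i\<close>. In a mixed bouquet both signs occur, so it sees the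
  positive and the negative part. In a free bouquet kernel vectors have coordinate zero. Hence
  divisibility between positive parts depends on the matrix only through the set of non-mixed
  bouquets.
\<close>

lemma pos_part_bouquet_map_dvd_iff:
  assumes u: "u \<in> kerZ (bouquet_matrix A c)" and v: "v \<in> kerZ (bouquet_matrix A c)"
  shows "expo_dvd (pos_part (bouquet_map c v)) (pos_part (bouquet_map c u)) \<longleftrightarrow>
    (\<forall>i. nat (v $ i) \<le> nat (u $ i) \<and>
      (\<not> non_mixed_bouquet G (B i) \<longrightarrow> nat (- v $ i) \<le> nat (- u $ i)))"
proof -
  have block: "(\<forall>j\<in>B i. nat (v $ i * c i $ j) \<le> nat (u $ i * c i $ j)) \<longleftrightarrow>
     nat (v $ i) \<le> nat (u $ i) \<and>
      (\<not> non_mixed_bouquet G (B i) \<longrightarrow> nat (- v $ i) \<le> nat (- u $ i))" for i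
  proof -
    consider "free_bouquet G (B i)" | "non_mixed_bouquet G (B i)" | "mixed_bouquet G (B i)"
      by (auto simp: non_mixed_bouquet_def)
    then show ?thesis
    proof cases
      case 1
      then show ?thesis using free_coordinate_zero u v by simp
    next
      case 2
      then show ?thesis using non_mixed_signs[OF 2] nat_scale_le_iff(1) first_in[of i] by auto
    next
      case 3
      then obtain j k where jk: "j \<in> B i" "k \<in> B i" "c i $ j > 0" "c i $ k < 0"
        by (rule mixed_signs)
      have "nat (v $ i * c i $ j) \<le> nat (u $ i * c i $ j)"
        if "nat (v $ i) \<le> nat (u $ i)" "nat (- v $ i) \<le> nat (- u $ i)" "j \<in> B i" for j
        using that bouquet_coordinate_nonzero[OF that(3)] nat_scale_le_iff[of "c i $ j"]
        by (metis linorder_neqE vector_uminus_component)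
      moreover have "\<not> non_mixed_bouquet G (B i)" using 3 by (simp add: non_mixed_bouquet_def)
      ultimately show ?thesis
        using jk nat_scale_le_iff(1)[OF jk(3)] nat_scale_le_iff(2)[OF jk(4)] by auto
    qed
  qed
  have "expo_dvd (pos_part (bouquet_map c v)) (pos_part (bouquet_map c u)) \<longleftrightarrow>
    (\<forall>i. \<forall>j\<in>B i. nat (v $ i * c i $ j) \<le> nat (u $ i * c i $ j))"
    unfolding expo_dvd_def lookup_pos_part
    using bouquet_map_nth bouquets_partition by metis
  then show ?thesis by (simp only: block)
qed

end

section \<open>Transfer of Groebner bases along a lattice correspondence\<close>

text \<open>
  What two robust ideals share: parametrizations of their lattices by one lattice that induce the same
  divisibility relation between positive parts. The assumptions are symmetric in the two sides, so each
  statement can be used in both directions.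
\<close>

locale lattice_correspondence =
  fixes T :: "int^'s^'t" and A\<^sub>1 :: "int^'n^'m" and A\<^sub>2 :: "int^'p^'q"
    and D\<^sub>1 :: "int^'s \<Rightarrow> int^'n" and D\<^sub>2 :: "int^'s \<Rightarrow> int^'p"
  assumes graded\<^sub>1: "positively_graded A\<^sub>1" and graded\<^sub>2: "positively_graded A\<^sub>2"
    and add\<^sub>1: "D\<^sub>1 (u + v) = D\<^sub>1 u + D\<^sub>1 v" and add\<^sub>2: "D\<^sub>2 (u + v) = D\<^sub>2 u + D\<^sub>2 v"
    and bij\<^sub>1: "bij_betw D\<^sub>1 (kerZ T) (kerZ A\<^sub>1)" and bij\<^sub>2: "bij_betw D\<^sub>2 (kerZ T) (kerZ A\<^sub>2)"
    and dvd_iff: "u \<in> kerZ T \<Longrightarrow> v \<in> kerZ T \<Longrightarrow>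
      expo_dvd (pos_part (D\<^sub>2 u)) (pos_part (D\<^sub>2 v)) \<longleftrightarrow>
      expo_dvd (pos_part (D\<^sub>1 u)) (pos_part (D\<^sub>1 v))"
begin

lemma swap: "lattice_correspondence T A\<^sub>2 A\<^sub>1 D\<^sub>2 D\<^sub>1"
  by unfold_locales (simp_all add: graded\<^sub>1 graded\<^sub>2 add\<^sub>1 add\<^sub>2 bij\<^sub>1 bij\<^sub>2 dvd_iff)

lemma D_zero: "D\<^sub>1 0 = 0" "D\<^sub>2 0 = 0"
  using add\<^sub>1[of 0 0] add\<^sub>2[of 0 0] by simp_all

lemma D_uminus: "D\<^sub>1 (- u) = - D\<^sub>1 u" "D\<^sub>2 (- u) = - D\<^sub>2 u"
  using add\<^sub>1[of u "- u"] add\<^sub>2[of u "- u"] by (simp_all add: D_zero minus_unique)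

lemma D\<^sub>2_in: "u \<in> kerZ T \<Longrightarrow> D\<^sub>2 u \<in> kerZ A\<^sub>2"
  by (rule bij_betw_apply[OF bij\<^sub>2])

lemma D\<^sub>1_eq_iff: "u \<in> kerZ T \<Longrightarrow> v \<in> kerZ T \<Longrightarrow> D\<^sub>1 u = D\<^sub>1 v \<longleftrightarrow> u = v"
  using inj_on_eq_iff[OF bij_betw_imp_inj_on[OF bij\<^sub>1]] .

lemma D\<^sub>2_eq_iff: "u \<in> kerZ T \<Longrightarrow> v \<in> kerZ T \<Longrightarrow> D\<^sub>2 u = D\<^sub>2 v \<longleftrightarrow> u = v"
  using inj_on_eq_iff[OF bij_betw_imp_inj_on[OF bij\<^sub>2]] .

lemma D_eq_0_iff: "u \<in> kerZ T \<Longrightarrow> D\<^sub>1 u = 0 \<longleftrightarrow> u = 0" "u \<in> kerZ T \<Longrightarrow> D\<^sub>2 u = 0 \<longleftrightarrow> u = 0"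
  using D\<^sub>1_eq_iff[of u 0] D\<^sub>2_eq_iff[of u 0] kerZ_zero[of T] by (simp_all add: D_zero)

text \<open>
  Different kernel vectors with the same binomial occur in characteristic two, for \<open>u\<close> and \<open>-u\<close>; then
  they have the same binomial on both sides. So the passage between binomials is well defined over
  every field.
\<close>

lemma toric_binomial_transfer:
  assumes "u \<in> kerZ T" "v \<in> kerZ T"
  shows "(toric_binomial (D\<^sub>2 u) :: ('p, 'k::field) mpoly) = toric_binomial (D\<^sub>2 v) \<longleftrightarrow>
    (toric_binomial (D\<^sub>1 u) :: ('n, 'k) mpoly) = toric_binomial (D\<^sub>1 v)"
  using assms kerZ_uminus[OF assms(2)]
  by (simp add: toric_binomial_eq_iff D\<^sub>1_eq_iff D\<^sub>2_eq_iff flip: D_uminus)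

text \<open>
  The signs that the first order gives to the vectors \<open>D\<^sub>1 u\<close> are prescribed for the vectors \<open>D\<^sub>2 u\<close>, and
  this is compatible with a monomial order: in the cone generated by the nonnegative orthant and
  the vectors \<open>D\<^sub>2 u\<close> that are to be nonnegative, two opposite elements \<open>a + D\<^sub>2 u\<close> and \<open>b + D\<^sub>2 v\<close> give
  the nonnegative kernel vector \<open>a + b = D\<^sub>2 (- (u + v))\<close>. The positive grading makes it zero, so \<open>a = b = 0\<close>
  and \<open>v = - u\<close>, and both \<open>u\<close> and \<open>-u\<close> are nonnegative for the first order, so \<open>u = 0\<close>.
\<close>

lemma transfer_order:
  assumes lt: "monomial_order lt\<^sub>1"
  obtains lt\<^sub>2 where "monomial_order lt\<^sub>2"
    "\<And>u. u \<in> kerZ T \<Longrightarrow> order_pos lt\<^sub>2 (D\<^sub>2 u) \<longleftrightarrow> order_pos lt\<^sub>1 (D\<^sub>1 u)"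
proof -
  define P where "P = {u \<in> kerZ T. u = 0 \<or> order_pos lt\<^sub>1 (D\<^sub>1 u)}"
  define N :: "(int^'p) set" where "N = {a. \<forall>i. 0 \<le> a $ i}"
  define C where "C = {a + D\<^sub>2 u | a u. a \<in> N \<and> u \<in> P}"
  have N: "0 \<in> N" "\<And>a b. a \<in> N \<Longrightarrow> b \<in> N \<Longrightarrow> a + b \<in> N"
      "\<And>a b. a \<in> N \<Longrightarrow> b \<in> N \<Longrightarrow> a + b = 0 \<Longrightarrow> a = 0"
    by (auto simp: N_def vec_eq_iff add_nonneg_eq_0_iff)
  have P_ker: "u \<in> kerZ T" if "u \<in> P" for u
    using that by (simp add: P_def)
  have P_add: "u + v \<in> P" if "u \<in> P" "v \<in> P" for u v
    using that order_pos_add[OF lt, of "D\<^sub>1 u" "D\<^sub>1 v"] by (auto simp: P_def kerZ_add add\<^sub>1 D_zero)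
  have P_pointed: "u = 0" if "u \<in> P" "- u \<in> P" for u
    using that order_pos_asym[OF lt, of "D\<^sub>1 u"] by (auto simp: P_def D_uminus)
  have "0 \<in> P" by (simp add: P_def kerZ_zero)
  then have "0 + D\<^sub>2 0 \<in> C" unfolding C_def using N(1) by blast
  then have C_zero: "0 \<in> C" by (simp add: D_zero)
  have C_add: "x + y \<in> C" if xy: "x \<in> C" "y \<in> C" for x y
  proof -
    obtain a u where x: "x = a + D\<^sub>2 u" "a \<in> N" "u \<in> P" using xy(1) unfolding C_def by blast
    obtain b v where y: "y = b + D\<^sub>2 v" "b \<in> N" "v \<in> P" using xy(2) unfolding C_def by blast
    have "x + y = (a + b) + D\<^sub>2 (u + v)" unfolding x(1) y(1) by (simp add: add\<^sub>2)
    then show ?thesis unfolding C_def using N(2)[OF x(2) y(2)] P_add[OF x(3) y(3)] by blast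
  qed
  have C_pointed: "x = 0" if xy: "x \<in> C" "- x \<in> C" for x
  proof -
    obtain a u where x: "x = a + D\<^sub>2 u" "a \<in> N" "u \<in> P" using xy(1) unfolding C_def by blast
    obtain b v where y: "- x = b + D\<^sub>2 v" "b \<in> N" "v \<in> P" using xy(2) unfolding C_def by blast
    have uv: "u + v \<in> kerZ T" by (intro kerZ_add P_ker x y)
    have "(a + D\<^sub>2 u) + (b + D\<^sub>2 v) = 0" using x(1) y(1) by (metis add.right_inverse)
    then have sum: "(a + b) + D\<^sub>2 (u + v) = 0" by (simp add: add\<^sub>2 ac_simps)
    then have "a + b = D\<^sub>2 (- (u + v))" unfolding D_uminus by (simp add: eq_neg_iff_add_eq_0)
    then have "a + b \<in> kerZ A\<^sub>2 \<inter> N"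
      using D\<^sub>2_in[OF kerZ_uminus[OF uv]] N(2)[OF x(2) y(2)] by simp
    then have ab: "a + b = 0" using graded\<^sub>2 unfolding positively_graded_def N_def by blast
    then have "a = 0" by (rule N(3)[OF x(2) y(2)])
    moreover have "u = 0"
    proof (rule P_pointed[OF x(3)])
      have "D\<^sub>2 (u + v) = 0" using sum ab by simp
      then have "u + v = 0" using D_eq_0_iff(2)[OF uv] by simp
      then have "v = - u" by (simp add: eq_neg_iff_add_eq_0 add.commute)
      then show "- u \<in> P" using y(3) by simp
    qed
    ultimately show ?thesis using x(1) by (simp add: D_zero)
  qed
  obtain Q where CQ: "C \<subseteq> Q" and Q: "\<And>x y. x \<in> Q \<Longrightarrow> y \<in> Q \<Longrightarrow> x + y \<in> Q"
    "\<And>x. x \<in> Q \<Longrightarrow> - x \<in> Q \<Longrightarrow> x = 0" "\<And>x. x \<in> Q \<or> - x \<in> Q"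
    using total_cone_extension[OF C_zero C_add C_pointed] by metis
  have NQ: "x \<in> Q" if "\<forall>i. 0 \<le> x $ i" for x
  proof -
    have "x = x + D\<^sub>2 0" by (simp add: D_zero)
    then have "x \<in> C" unfolding C_def using that \<open>0 \<in> P\<close> N_def by blast
    then show ?thesis using CQ by blast
  qed
  obtain lt\<^sub>2 where lt2: "monomial_order lt\<^sub>2" "\<And>u. order_pos lt\<^sub>2 u \<longleftrightarrow> u \<in> Q \<and> u \<noteq> 0"
    using monomial_order_of_cone[OF Q NQ] by blast
  have PQ: "D\<^sub>2 u \<in> Q" if "u \<in> P" for u
  proof -
    have "D\<^sub>2 u = 0 + D\<^sub>2 u" by simp
    then have "D\<^sub>2 u \<in> C" unfolding C_def using that N(1) by blast
    then show ?thesis using CQ by blast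
  qed
  show ?thesis
  proof (rule that[OF lt2(1)])
    fix u assume u: "u \<in> kerZ T"
    show "order_pos lt\<^sub>2 (D\<^sub>2 u) \<longleftrightarrow> order_pos lt\<^sub>1 (D\<^sub>1 u)"
    proof (cases "u = 0")
      case True
      then show ?thesis by (simp add: D_zero order_pos_irrefl lt lt2(1))
    next
      case False
      have "D\<^sub>2 u \<in> Q \<longleftrightarrow> u \<in> P"
      proof
        assume DQ: "D\<^sub>2 u \<in> Q"
        show "u \<in> P"
        proof (rule ccontr)
          assume "u \<notin> P"
          then have "- u \<in> P"
            using u False order_pos_total[OF lt, of "D\<^sub>1 u"]
            by (auto simp: P_def D_uminus D_eq_0_iff kerZ_uminus)
          then have "- D\<^sub>2 u \<in> Q" using PQ[of "- u"] by (simp add: D_uminus)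
          then show False using Q(2)[OF DQ] u False by (simp add: D_eq_0_iff)
        qed
      qed (rule PQ)
      then show ?thesis using u False by (simp add: lt2(2) D_eq_0_iff P_def)
    qed
  qed
qed

lemma corresponding_basis_image:
  assumes "S \<subseteq> kerZ T"
  shows "(corresponding_basis T D\<^sub>1 D\<^sub>2 (toric_binomial ` D\<^sub>1 ` S) :: ('p, 'k::field) mpoly set) =
    toric_binomial ` D\<^sub>2 ` S"
proof (intro equalityI subsetI)
  fix g :: "('p, 'k) mpoly"
  assume "g \<in> corresponding_basis T D\<^sub>1 D\<^sub>2 (toric_binomial ` D\<^sub>1 ` S)"
  then obtain u v where uv: "u \<in> kerZ T" "g = toric_binomial (D\<^sub>2 u)" "v \<in> S"
    "(toric_binomial (D\<^sub>1 u) :: ('n, 'k) mpoly) = toric_binomial (D\<^sub>1 v)"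
    unfolding corresponding_basis_def by auto
  have "g = toric_binomial (D\<^sub>2 v)"
    unfolding uv(2) using uv(4) toric_binomial_transfer[OF uv(1), of v] uv(3) assms by blast
  then show "g \<in> toric_binomial ` D\<^sub>2 ` S" using uv(3) by simp
next
  fix g :: "('p, 'k) mpoly"
  assume "g \<in> toric_binomial ` D\<^sub>2 ` S"
  then obtain u where u: "u \<in> S" "g = toric_binomial (D\<^sub>2 u)" by auto
  then show "g \<in> corresponding_basis T D\<^sub>1 D\<^sub>2 (toric_binomial ` D\<^sub>1 ` S)"
    unfolding corresponding_basis_def using assms by auto
qed

definition orders_agree :: "('n expo \<Rightarrow> 'n expo \<Rightarrow> bool) \<Rightarrow> ('p expo \<Rightarrow> 'p expo \<Rightarrow> bool) \<Rightarrow> bool" where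
  "orders_agree lt\<^sub>1 lt\<^sub>2 \<longleftrightarrow>
     (\<forall>u\<in>kerZ T. order_pos lt\<^sub>2 (D\<^sub>2 u) \<longleftrightarrow> order_pos lt\<^sub>1 (D\<^sub>1 u))"

lemma positive_vectors_images:
  assumes "orders_agree lt\<^sub>1 lt\<^sub>2"
  defines "P \<equiv> {u \<in> kerZ T. order_pos lt\<^sub>1 (D\<^sub>1 u)}"
  shows "positive_vectors lt\<^sub>1 A\<^sub>1 = D\<^sub>1 ` P" "positive_vectors lt\<^sub>2 A\<^sub>2 = D\<^sub>2 ` P"
  using assms(1) bij_betw_imp_surj_on[OF bij\<^sub>1, symmetric]
    bij_betw_imp_surj_on[OF bij\<^sub>2, symmetric]
  by (auto simp: positive_vectors_def P_def orders_agree_def)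

lemma pos_part_transfer:
  assumes "u \<in> kerZ T" "v \<in> kerZ T"
  shows "pos_part (D\<^sub>2 u) = pos_part (D\<^sub>2 v) \<longleftrightarrow> pos_part (D\<^sub>1 u) = pos_part (D\<^sub>1 v)"
  using dvd_iff[OF assms] dvd_iff[OF assms(2,1)] expo_dvd_antisym expo_dvd_refl by metis

text \<open>
  The negative part of \<open>D u\<close> is the positive part of \<open>D (- u)\<close>, so the standardness of tails is covered by
  the divisibility relation between positive parts as well.
\<close>

lemma reduced_vectors_images:
  assumes "orders_agree lt\<^sub>1 lt\<^sub>2"
  obtains R where "R \<subseteq> kerZ T" "reduced_vectors lt\<^sub>1 A\<^sub>1 = D\<^sub>1 ` R" "reduced_vectors lt\<^sub>2 A\<^sub>2 = D\<^sub>2 ` R"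
proof -
  define P where "P = {u \<in> kerZ T. order_pos lt\<^sub>1 (D\<^sub>1 u)}"
  define R where "R = {u \<in> P. \<forall>v\<in>P.
     (expo_dvd (pos_part (D\<^sub>1 v)) (pos_part (D\<^sub>1 u)) \<longrightarrow> pos_part (D\<^sub>1 v) = pos_part (D\<^sub>1 u)) \<and>
     \<not> expo_dvd (pos_part (D\<^sub>1 v)) (pos_part (D\<^sub>1 (- u)))}"
  note images = positive_vectors_images[OF assms, folded P_def]
  have P: "u \<in> kerZ T" "- u \<in> kerZ T" if "u \<in> P" for u
    using that kerZ_uminus by (auto simp: P_def)
  have R2: "R = {u \<in> P. \<forall>v\<in>P.
     (expo_dvd (pos_part (D\<^sub>2 v)) (pos_part (D\<^sub>2 u)) \<longrightarrow> pos_part (D\<^sub>2 v) = pos_part (D\<^sub>2 u)) \<and>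
     \<not> expo_dvd (pos_part (D\<^sub>2 v)) (pos_part (D\<^sub>2 (- u)))}"
    unfolding R_def by (simp add: P dvd_iff pos_part_transfer cong: conj_cong)
  have "R \<subseteq> kerZ T" using P(1) by (auto simp: R_def)
  moreover have "reduced_vectors lt\<^sub>1 A\<^sub>1 = D\<^sub>1 ` R"
    unfolding reduced_vectors_def images R_def neg_part_eq by (auto simp: D_uminus)
  moreover have "reduced_vectors lt\<^sub>2 A\<^sub>2 = D\<^sub>2 ` R"
    unfolding reduced_vectors_def images R2 neg_part_eq by (auto simp: D_uminus)
  ultimately show ?thesis by (rule that)
qed

lemma transfer_reduced_groebner_basis:
  fixes \<G> :: "('n, 'k::field) mpoly set"
  assumes lt: "monomial_order lt\<^sub>1" "monomial_order lt\<^sub>2" "orders_agree lt\<^sub>1 lt\<^sub>2"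
    and rgb: "reduced_groebner_basis lt\<^sub>1 (toric_ideal A\<^sub>1) \<G>"
  shows "reduced_groebner_basis lt\<^sub>2 (toric_ideal A\<^sub>2) (corresponding_basis T D\<^sub>1 D\<^sub>2 \<G>)"
proof -
  define P where "P = {u \<in> kerZ T. order_pos lt\<^sub>1 (D\<^sub>1 u)}"
  note images = positive_vectors_images[OF lt(3), folded P_def]
  obtain R where R: "R \<subseteq> kerZ T" "reduced_vectors lt\<^sub>1 A\<^sub>1 = D\<^sub>1 ` R" "reduced_vectors lt\<^sub>2 A\<^sub>2 = D\<^sub>2 ` R"
    by (rule reduced_vectors_images[OF lt(3)])
  have fin: "finite (D\<^sub>1 ` R)"
    and cover: "\<forall>v\<in>P. \<exists>u\<in>R. expo_dvd (pos_part (D\<^sub>1 u)) (pos_part (D\<^sub>1 v))"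
    and eq: "\<G> = toric_binomial ` D\<^sub>1 ` R"
    using rgb unfolding reduced_groebner_basis_toric_iff[OF lt(1)] R(2) images by auto
  have "finite R"
    using finite_imageD[OF fin] inj_on_subset[OF bij_betw_imp_inj_on[OF bij\<^sub>1] R(1)] by blast
  moreover have "\<exists>u\<in>R. expo_dvd (pos_part (D\<^sub>2 u)) (pos_part (D\<^sub>2 v))" if v: "v \<in> P" for v
  proof -
    obtain u where u: "u \<in> R" "expo_dvd (pos_part (D\<^sub>1 u)) (pos_part (D\<^sub>1 v))"
      using cover v by blast
    have "expo_dvd (pos_part (D\<^sub>2 u)) (pos_part (D\<^sub>2 v))"
      using u v R(1) by (subst dvd_iff) (auto simp: P_def)
    then show ?thesis using u(1) by blast
  qed
  ultimately show ?thesis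
    unfolding reduced_groebner_basis_toric_iff[OF lt(2)] R(3) images eq
      corresponding_basis_image[OF R(1)]
    by simp
qed

lemma transfer_initial_ideal:
  assumes lt: "monomial_order lt\<^sub>1" "monomial_order lt\<^sub>2" "orders_agree lt\<^sub>1 lt\<^sub>2"
    and S: "S \<subseteq> kerZ T"
    and init: "(initial_ideal lt\<^sub>1 (toric_ideal A\<^sub>1) :: ('n, 'k::field) mpoly set) =
      ideal ((\<lambda>u. monomial (pos_part (D\<^sub>1 u))) ` S)"
  shows "(initial_ideal lt\<^sub>2 (toric_ideal A\<^sub>2) :: ('p, 'k) mpoly set) =
      ideal ((\<lambda>u. monomial (pos_part (D\<^sub>2 u))) ` S)"
proof -
  define P where "P = {u \<in> kerZ T. order_pos lt\<^sub>1 (D\<^sub>1 u)}"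
  note images = positive_vectors_images[OF lt(3), folded P_def]
  have im1: "(\<lambda>u. monomial (pos_part (D\<^sub>1 u)) :: ('n, 'k) mpoly) ` S = monomial ` pos_part ` D\<^sub>1 ` S"
    and im2: "(\<lambda>u. monomial (pos_part (D\<^sub>2 u)) :: ('p, 'k) mpoly) ` S = monomial ` pos_part ` D\<^sub>2 ` S"
    by (simp_all add: image_image)
  have P: "P \<subseteq> kerZ T" by (auto simp: P_def)
  have "(\<exists>u\<in>Y. expo_dvd (pos_part (D\<^sub>2 u)) (pos_part (D\<^sub>2 v))) \<longleftrightarrow>
      (\<exists>u\<in>Y. expo_dvd (pos_part (D\<^sub>1 u)) (pos_part (D\<^sub>1 v)))"
    if "Y \<subseteq> kerZ T" "v \<in> kerZ T" for Y v
    using that dvd_iff[of _ v] by (intro bex_cong) auto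
  note this[OF P] this[OF S]
  then have "(\<forall>v\<in>P. \<exists>u\<in>S. expo_dvd (pos_part (D\<^sub>2 u)) (pos_part (D\<^sub>2 v))) \<and>
      (\<forall>v\<in>S. \<exists>u\<in>P. expo_dvd (pos_part (D\<^sub>2 u)) (pos_part (D\<^sub>2 v)))"
    using init P S
    unfolding im1 initial_toric_ideal[OF lt(1)] monomial_ideal_eq_iff images by auto
  then show ?thesis
    unfolding im2 initial_toric_ideal[OF lt(2)] monomial_ideal_eq_iff images by auto
qed

lemma obtain_agreeing_order:
  assumes "monomial_order lt\<^sub>1"
  obtains lt\<^sub>2 where "monomial_order lt\<^sub>2" "orders_agree lt\<^sub>1 lt\<^sub>2"
  using transfer_order[OF assms] unfolding orders_agree_def by metis

lemma corresponding_basis_maps_to: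
  assumes "\<G> \<in> reduced_groebner_bases (toric_ideal A\<^sub>1 :: ('n, 'k::field) mpoly set)"
  shows "corresponding_basis T D\<^sub>1 D\<^sub>2 \<G> \<in> reduced_groebner_bases (toric_ideal A\<^sub>2)"
proof -
  obtain lt\<^sub>1 where lt1: "monomial_order lt\<^sub>1" "reduced_groebner_basis lt\<^sub>1 (toric_ideal A\<^sub>1) \<G>"
    using assms by (auto simp: reduced_groebner_bases_def)
  obtain lt\<^sub>2 where lt2: "monomial_order lt\<^sub>2" "orders_agree lt\<^sub>1 lt\<^sub>2"
    by (rule obtain_agreeing_order[OF lt1(1)])
  show ?thesis
    unfolding reduced_groebner_bases_def
    using lt2(1) transfer_reduced_groebner_basis[OF lt1(1) lt2 lt1(2)] by blast
qed

lemma reduced_groebner_basis_image: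
  assumes "\<G> \<in> reduced_groebner_bases (toric_ideal A\<^sub>1 :: ('n, 'k::field) mpoly set)"
  obtains R where "R \<subseteq> kerZ T" "\<G> = toric_binomial ` D\<^sub>1 ` R"
proof -
  obtain lt\<^sub>1 where lt1: "monomial_order lt\<^sub>1" "reduced_groebner_basis lt\<^sub>1 (toric_ideal A\<^sub>1) \<G>"
    using assms by (auto simp: reduced_groebner_bases_def)
  obtain lt\<^sub>2 where lt2: "monomial_order lt\<^sub>2" "orders_agree lt\<^sub>1 lt\<^sub>2"
    by (rule obtain_agreeing_order[OF lt1(1)])
  obtain R where R: "R \<subseteq> kerZ T" "reduced_vectors lt\<^sub>1 A\<^sub>1 = D\<^sub>1 ` R"
    by (rule reduced_vectors_images[OF lt2(2)])
  show ?thesis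
    using that[OF R(1)] lt1(2) unfolding reduced_groebner_basis_toric_iff[OF lt1(1)] R(2) by simp
qed

lemma corresponding_basis_inverse:
  assumes "\<G> \<in> reduced_groebner_bases (toric_ideal A\<^sub>1 :: ('n, 'k::field) mpoly set)"
  shows "corresponding_basis T D\<^sub>2 D\<^sub>1 (corresponding_basis T D\<^sub>1 D\<^sub>2 \<G>) = \<G>"
proof -
  obtain R where R: "R \<subseteq> kerZ T" "\<G> = toric_binomial ` D\<^sub>1 ` R"
    by (rule reduced_groebner_basis_image[OF assms])
  show ?thesis
    unfolding R(2) corresponding_basis_image[OF R(1)]
    by (rule lattice_correspondence.corresponding_basis_image[OF swap R(1)])
qed

text \<open>
  The vector \<open>u\<close> is chosen, as it is determined only up to sign in characteristic two; the binomial of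
  \<open>D\<^sub>2 u\<close> does not depend on the choice.
\<close>

definition corresponding_element :: "('n, 'k::field) mpoly \<Rightarrow> ('p, 'k) mpoly" where
  "corresponding_element g = toric_binomial (D\<^sub>2 (SOME u. u \<in> kerZ T \<and> toric_binomial (D\<^sub>1 u) = g))"

lemma corresponding_element_binomial:
  assumes "u \<in> kerZ T"
  shows "corresponding_element (toric_binomial (D\<^sub>1 u) :: ('n, 'k::field) mpoly) =
    toric_binomial (D\<^sub>2 u)"
proof -
  define v where
    "v = (SOME v. v \<in> kerZ T \<and> (toric_binomial (D\<^sub>1 v) :: ('n, 'k) mpoly) = toric_binomial (D\<^sub>1 u))"
  have "v \<in> kerZ T \<and> (toric_binomial (D\<^sub>1 v) :: ('n, 'k) mpoly) = toric_binomial (D\<^sub>1 u)"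
    unfolding v_def by (rule someI[of _ u]) (simp add: assms)
  then have "(toric_binomial (D\<^sub>2 v) :: ('p, 'k) mpoly) = toric_binomial (D\<^sub>2 u)"
    using toric_binomial_transfer[of v u] assms by blast
  then show ?thesis by (simp add: corresponding_element_def v_def)
qed

lemma universal_groebner_basis_element:
  assumes "g \<in> universal_groebner_basis (toric_ideal A\<^sub>1 :: ('n, 'k::field) mpoly set)"
  obtains u where "u \<in> kerZ T" "g = toric_binomial (D\<^sub>1 u)"
    "(toric_binomial (D\<^sub>2 u) :: ('p, 'k) mpoly) \<in> universal_groebner_basis (toric_ideal A\<^sub>2)"
proof -
  obtain \<G> where G: "\<G> \<in> reduced_groebner_bases (toric_ideal A\<^sub>1)" "g \<in> \<G>"
    using assms by (auto simp: universal_groebner_basis_def)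
  obtain R where R: "R \<subseteq> kerZ T" "\<G> = toric_binomial ` D\<^sub>1 ` R"
    by (rule reduced_groebner_basis_image[OF G(1)])
  obtain u where u: "u \<in> R" "g = toric_binomial (D\<^sub>1 u)" using G(2) R(2) by auto
  have "(toric_binomial (D\<^sub>2 u) :: ('p, 'k) mpoly) \<in> corresponding_basis T D\<^sub>1 D\<^sub>2 \<G>"
    using u R(1) unfolding R(2) corresponding_basis_image[OF R(1)] by simp
  then have "(toric_binomial (D\<^sub>2 u) :: ('p, 'k) mpoly) \<in> universal_groebner_basis (toric_ideal A\<^sub>2)"
    using corresponding_basis_maps_to[OF G(1)] unfolding universal_groebner_basis_def by blast
  then show ?thesis using that[of u] u R(1) by blast
qed

end

lemma (in lattice_correspondence) corresponding_basis_bij: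
  "bij_betw (corresponding_basis T D\<^sub>1 D\<^sub>2)
     (reduced_groebner_bases (toric_ideal A\<^sub>1 :: ('n, 'k::field) mpoly set))
     (reduced_groebner_bases (toric_ideal A\<^sub>2))"
proof -
  interpret swapped: lattice_correspondence T A\<^sub>2 A\<^sub>1 D\<^sub>2 D\<^sub>1 by (rule swap)
  show ?thesis
    by (rule bij_betw_byWitness[where f' = "corresponding_basis T D\<^sub>2 D\<^sub>1"])
      (simp_all add: corresponding_basis_inverse swapped.corresponding_basis_inverse
        corresponding_basis_maps_to swapped.corresponding_basis_maps_to image_subsetI)
qed

lemma (in lattice_correspondence) corresponding_element_bij:
  "bij_betw corresponding_element
     (universal_groebner_basis (toric_ideal A\<^sub>1 :: ('n, 'k::field) mpoly set))
     (universal_groebner_basis (toric_ideal A\<^sub>2))"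
proof -
  interpret swapped: lattice_correspondence T A\<^sub>2 A\<^sub>1 D\<^sub>2 D\<^sub>1 by (rule swap)
  show ?thesis
  proof (rule bij_betw_byWitness[where f' = swapped.corresponding_element])
    show "\<forall>g\<in>universal_groebner_basis (toric_ideal A\<^sub>1 :: ('n, 'k) mpoly set).
        swapped.corresponding_element (corresponding_element g) = g"
    proof
      fix g :: "('n, 'k) mpoly" assume "g \<in> universal_groebner_basis (toric_ideal A\<^sub>1)"
      then obtain u where "u \<in> kerZ T" "g = toric_binomial (D\<^sub>1 u)"
        by (rule universal_groebner_basis_element)
      then show "swapped.corresponding_element (corresponding_element g) = g"
        by (simp add: corresponding_element_binomial swapped.corresponding_element_binomial)
    qed
    show "\<forall>g\<in>universal_groebner_basis (toric_ideal A\<^sub>2 :: ('p, 'k) mpoly set).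
        corresponding_element (swapped.corresponding_element g) = g"
    proof
      fix g :: "('p, 'k) mpoly" assume "g \<in> universal_groebner_basis (toric_ideal A\<^sub>2)"
      then obtain u where "u \<in> kerZ T" "g = toric_binomial (D\<^sub>2 u)"
        by (rule swapped.universal_groebner_basis_element)
      then show "corresponding_element (swapped.corresponding_element g) = g"
        by (simp add: corresponding_element_binomial swapped.corresponding_element_binomial)
    qed
    show "corresponding_element ` universal_groebner_basis (toric_ideal A\<^sub>1 :: ('n, 'k) mpoly set)
        \<subseteq> universal_groebner_basis (toric_ideal A\<^sub>2)"
    proof (rule image_subsetI)
      fix g :: "('n, 'k) mpoly" assume "g \<in> universal_groebner_basis (toric_ideal A\<^sub>1)"
      then obtain u where "u \<in> kerZ T" "g = toric_binomial (D\<^sub>1 u)"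
          "(toric_binomial (D\<^sub>2 u) :: ('p, 'k) mpoly) \<in> universal_groebner_basis (toric_ideal A\<^sub>2)"
        by (rule universal_groebner_basis_element)
      then show "corresponding_element g \<in> universal_groebner_basis (toric_ideal A\<^sub>2)"
        by (simp add: corresponding_element_binomial)
    qed
    show "swapped.corresponding_element ` universal_groebner_basis (toric_ideal A\<^sub>2 :: ('p, 'k) mpoly set)
        \<subseteq> universal_groebner_basis (toric_ideal A\<^sub>1)"
    proof (rule image_subsetI)
      fix g :: "('p, 'k) mpoly" assume "g \<in> universal_groebner_basis (toric_ideal A\<^sub>2)"
      then obtain u where "u \<in> kerZ T" "g = toric_binomial (D\<^sub>2 u)"
          "(toric_binomial (D\<^sub>1 u) :: ('n, 'k) mpoly) \<in> universal_groebner_basis (toric_ideal A\<^sub>1)"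
        by (rule swapped.universal_groebner_basis_element)
      then show "swapped.corresponding_element g \<in> universal_groebner_basis (toric_ideal A\<^sub>1)"
        by (simp add: swapped.corresponding_element_binomial)
    qed
  qed
qed

section \<open>Robust toric ideals\<close>

lemma robust_correspondence:
  fixes T :: "int^'s^'t" and A\<^sub>1 :: "int^'n^'m" and A\<^sub>2 :: "int^'p^'q"
    and I\<^sub>T :: "('s, 'k::field) mpoly set"
  assumes I\<^sub>T: "I\<^sub>T = toric_ideal T"
    and graded: "positively_graded A\<^sub>1" "positively_graded A\<^sub>2"
    and robust\<^sub>1: "robust I\<^sub>T \<omega> A\<^sub>1 G\<^sub>1 B\<^sub>1 f\<^sub>1 c\<^sub>1"
    and robust\<^sub>2: "robust I\<^sub>T \<omega> A\<^sub>2 G\<^sub>2 B\<^sub>2 f\<^sub>2 c\<^sub>2"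
  shows "lattice_correspondence T A\<^sub>1 A\<^sub>2 (bouquet_map c\<^sub>1) (bouquet_map c\<^sub>2)"
proof -
  interpret b1: bouquet_decomposition A\<^sub>1 G\<^sub>1 B\<^sub>1 f\<^sub>1 c\<^sub>1
    using robust\<^sub>1 by unfold_locales (simp add: robust_def)
  interpret b2: bouquet_decomposition A\<^sub>2 G\<^sub>2 B\<^sub>2 f\<^sub>2 c\<^sub>2
    using robust\<^sub>2 by unfold_locales (simp add: robust_def)
  have ker1: "kerZ (bouquet_matrix A\<^sub>1 c\<^sub>1) = kerZ T"
    using robust\<^sub>1 I\<^sub>T by (intro kerZ_eq_of_toric_ideal_eq[where 'k = 'k]) (simp add: robust_def)
  have ker2: "kerZ (bouquet_matrix A\<^sub>2 c\<^sub>2) = kerZ T"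
    using robust\<^sub>2 I\<^sub>T by (intro kerZ_eq_of_toric_ideal_eq[where 'k = 'k]) (simp add: robust_def)
  have \<omega>: "non_mixed_bouquet G\<^sub>1 (B\<^sub>1 i) \<longleftrightarrow> i \<in> \<omega>" "non_mixed_bouquet G\<^sub>2 (B\<^sub>2 i) \<longleftrightarrow> i \<in> \<omega>" for i
    using robust\<^sub>1 robust\<^sub>2 by (auto simp: robust_def)
  show ?thesis
  proof
    show "bij_betw (bouquet_map c\<^sub>1) (kerZ T) (kerZ A\<^sub>1)" "bij_betw (bouquet_map c\<^sub>2) (kerZ T) (kerZ A\<^sub>2)"
      using b1.bouquet_map_bij b2.bouquet_map_bij by (simp_all add: ker1 ker2)
    show "expo_dvd (pos_part (bouquet_map c\<^sub>2 u)) (pos_part (bouquet_map c\<^sub>2 v)) \<longleftrightarrow>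
      expo_dvd (pos_part (bouquet_map c\<^sub>1 u)) (pos_part (bouquet_map c\<^sub>1 v))"
      if "u \<in> kerZ T" "v \<in> kerZ T" for u v
      using that b1.pos_part_bouquet_map_dvd_iff[of v u] b2.pos_part_bouquet_map_dvd_iff[of v u]
      by (simp add: ker1 ker2 \<omega>)
  qed (simp_all add: graded b1.bouquet_map_add b2.bouquet_map_add)
qed

theorem theorem2p3:
  fixes T :: "int^'s^'t" and A\<^sub>1 :: "int^'n^'m" and A\<^sub>2 :: "int^'p^'q"
    and \<omega> :: "'s set"
    and I\<^sub>T :: "('s, 'k::field) mpoly set"
    and I\<^sub>1 :: "('n, 'k) mpoly set" and I\<^sub>2 :: "('p, 'k) mpoly set"
    and D\<^sub>1 :: "int^'s \<Rightarrow> int^'n" and D\<^sub>2 :: "int^'s \<Rightarrow> int^'p"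
    and G\<^sub>1 :: "(int^'n) list" and G\<^sub>2 :: "(int^'p) list"
    and B\<^sub>1 :: "'s \<Rightarrow> 'n set" and B\<^sub>2 :: "'s \<Rightarrow> 'p set"
    and f\<^sub>1 :: "'s \<Rightarrow> 'n" and f\<^sub>2 :: "'s \<Rightarrow> 'p"
    and c\<^sub>1 :: "'s \<Rightarrow> int^'n" and c\<^sub>2 :: "'s \<Rightarrow> int^'p"
  assumes I\<^sub>T: "I\<^sub>T = toric_ideal T" and simple: "simple_toric T"
    and I\<^sub>1: "I\<^sub>1 = toric_ideal A\<^sub>1" and graded\<^sub>1: "positively_graded A\<^sub>1"
    and I\<^sub>2: "I\<^sub>2 = toric_ideal A\<^sub>2" and graded\<^sub>2: "positively_graded A\<^sub>2"
    and robust\<^sub>1: "robust I\<^sub>T \<omega> A\<^sub>1 G\<^sub>1 B\<^sub>1 f\<^sub>1 c\<^sub>1"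
    and robust\<^sub>2: "robust I\<^sub>T \<omega> A\<^sub>2 G\<^sub>2 B\<^sub>2 f\<^sub>2 c\<^sub>2"
    and D\<^sub>1: "D\<^sub>1 = bouquet_map c\<^sub>1" and D\<^sub>2: "D\<^sub>2 = bouquet_map c\<^sub>2"
  shows "(\<forall>lt\<^sub>1 \<G>. monomial_order lt\<^sub>1 \<and> reduced_groebner_basis lt\<^sub>1 I\<^sub>1 \<G> \<longrightarrow>
           (\<exists>lt\<^sub>2. monomial_order lt\<^sub>2 \<and>
              reduced_groebner_basis lt\<^sub>2 I\<^sub>2 (corresponding_basis T D\<^sub>1 D\<^sub>2 \<G>) \<and>
              (\<forall>us. set us \<subseteq> kerZ T \<and>
                 initial_ideal lt\<^sub>1 I\<^sub>1 = ideal ((\<lambda>u. monomial (pos_part (D\<^sub>1 u))) ` set us) \<longrightarrow>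
                 initial_ideal lt\<^sub>2 I\<^sub>2 = ideal ((\<lambda>u. monomial (pos_part (D\<^sub>2 u))) ` set us)))) \<and>
         bij_betw (corresponding_basis T D\<^sub>1 D\<^sub>2)
           (reduced_groebner_bases I\<^sub>1) (reduced_groebner_bases I\<^sub>2) \<and>
         (\<exists>\<phi>. bij_betw \<phi> (universal_groebner_basis I\<^sub>1) (universal_groebner_basis I\<^sub>2) \<and>
           (\<forall>u \<in> kerZ T. toric_binomial (D\<^sub>1 u) \<in> universal_groebner_basis I\<^sub>1 \<longrightarrow>
              \<phi> (toric_binomial (D\<^sub>1 u)) = toric_binomial (D\<^sub>2 u)))"
proof -
  interpret lattice_correspondence T A\<^sub>1 A\<^sub>2 D\<^sub>1 D\<^sub>2
    unfolding D\<^sub>1 D\<^sub>2 by (rule robust_correspondence[OF I\<^sub>T graded\<^sub>1 graded\<^sub>2 robust\<^sub>1 robust\<^sub>2])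
  show ?thesis
  proof (intro conjI allI impI)
    fix lt\<^sub>1 and \<G> :: "('n, 'k) mpoly set"
    assume "monomial_order lt\<^sub>1 \<and> reduced_groebner_basis lt\<^sub>1 I\<^sub>1 \<G>"
    then have lt1: "monomial_order lt\<^sub>1" "reduced_groebner_basis lt\<^sub>1 (toric_ideal A\<^sub>1) \<G>"
      by (simp_all add: I\<^sub>1)
    obtain lt\<^sub>2 where lt2: "monomial_order lt\<^sub>2" "orders_agree lt\<^sub>1 lt\<^sub>2"
      by (rule obtain_agreeing_order[OF lt1(1)])
    show "\<exists>lt\<^sub>2. monomial_order lt\<^sub>2 \<and>
        reduced_groebner_basis lt\<^sub>2 I\<^sub>2 (corresponding_basis T D\<^sub>1 D\<^sub>2 \<G>) \<and>
        (\<forall>us. set us \<subseteq> kerZ T \<and>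
           initial_ideal lt\<^sub>1 I\<^sub>1 = ideal ((\<lambda>u. monomial (pos_part (D\<^sub>1 u))) ` set us) \<longrightarrow>
           initial_ideal lt\<^sub>2 I\<^sub>2 = ideal ((\<lambda>u. monomial (pos_part (D\<^sub>2 u))) ` set us))"
      unfolding I\<^sub>1 I\<^sub>2
      using lt2(1) transfer_reduced_groebner_basis[OF lt1(1) lt2 lt1(2)]
        transfer_initial_ideal[OF lt1(1) lt2, where 'k = 'k]
      by (intro exI[of _ lt\<^sub>2]) simp
  next
    show "bij_betw (corresponding_basis T D\<^sub>1 D\<^sub>2)
        (reduced_groebner_bases I\<^sub>1) (reduced_groebner_bases I\<^sub>2)"
      unfolding I\<^sub>1 I\<^sub>2 by (rule corresponding_basis_bij)
    show "\<exists>\<phi>. bij_betw \<phi> (universal_groebner_basis I\<^sub>1) (universal_groebner_basis I\<^sub>2) \<and>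
        (\<forall>u \<in> kerZ T. toric_binomial (D\<^sub>1 u) \<in> universal_groebner_basis I\<^sub>1 \<longrightarrow>
           \<phi> (toric_binomial (D\<^sub>1 u)) = toric_binomial (D\<^sub>2 u))"
      unfolding I\<^sub>1 I\<^sub>2
      by (intro exI[of _ corresponding_element] conjI corresponding_element_bij)
        (simp add: corresponding_element_binomial)
  qed
qed

end
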